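(* Let $|G\rangle$ be the weighted graph state of a weighted graph $G=(V,E,\Theta)$ on $n$ vertices, let $\mathscr{A}=\{A_1,\dots,A_m\}$ be an independence cover of $V$, let $h\ge1$ and $N\ge1$ be integers, and let $\beta\in(0,1]$ satisfy $\beta\ge\frac1{N+1}$. Let $\Omega_h(\mathscr{A})=\frac1m\sum_{l=1}^mP_{l;h}$ be the test operator defined in the context. Then: (1) the state $|G\rangle^{\otimes(N+1)}$ passes the $N$-random sampling test of $\Omega_h(\mathscr{A})$ with probability at least $\left(1-\sin^2\frac{\pi}{4h}\right)^{N\max_l|A_l|}$; (2) when the $N$-random sampling test of $\Omega_h(\mathscr{A})$ is passed, the resultant state $\sigma$ satisfies, with significance level $\beta$, $$\langle G|\sigma|G\rangle\ \ge\ 1-\left[\frac{m(1-\beta)}{\beta N}+n\sin\frac{\pi}{4h}\right].$$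
   Context: **Weighted graph states.** A weighted graph $G=(V,E,\Theta)$ consists of a finite vertex set $V=[n]=\{1,\dots,n\}$, a set $E$ of edges, and real weights $\Theta=\{\theta_{jk}\}_{j<k}$, with $\theta_{jk}=0$ if $(j,k)\notin E$; put $\theta_{kj}=\theta_{jk}$. One qubit $\mathbb{C}^2$ is placed on each vertex. With $|+\rangle=(|0\rangle+|1\rangle)/\sqrt2$ and $\Lambda_{jk}(\theta)=|0\rangle\langle 0|_j\otimes I_k+|1\rangle\langle 1|_j\otimes(|0\rangle\langle 0|_k+e^{i\theta}|1\rangle\langle1|_k)$, the weighted graph state is $|G\rangle=\big[\prod_{(j,k)\in E}\Lambda_{jk}(\theta_{jk})\big]|+\rangle^{\otimes n}$. **Independence cover.** A subset of $V$ is independent if no two of its vertices are joined by an edge. An independence cover $\mathscr{A}=\{A_1,\dots,A_m\}$ is a set of independent sets with $\bigcup_l A_l=V$; throughout, the $A_l$ are nonempty and pairwise disjoint. $A_l^c=V\setminus A_l$, and $|A_l|$ is the number of elements of $A_l$. **Test operator.** For real $\alpha$ put $|\alpha\rangle=\frac1{\sqrt2}(|0\rangle+e^{i\alpha}|1\rangle)$. For $k\in A_l$, let $C_k\subset A_l^c$ be the set of neighbours of $k$, and for $\mathbf z=(z_j)_{j\in A_l^c}\in\{0,1\}^{A_l^c}$ put $\alpha_k(\mathbf z)=\sum_{j\in C_k}\theta_{jk}z_j$. Let $\alpha_k^h(\mathbf z)=\frac{t\pi}{h}$, where $t$ is the unique integer with $\frac{t\pi}{h}-\frac{\pi}{2h}\le\alpha_k(\mathbf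 z)<\frac{t\pi}{h}+\frac{\pi}{2h}$. Define $$P_{l;h}=\sum_{\mathbf z\in\{0,1\}^{A_l^c}}\Big(\bigotimes_{k\in A_l}|\alpha_k^h(\mathbf z)\rangle\langle\alpha_k^h(\mathbf z)|_k\Big)\otimes|\mathbf z\rangle\langle\mathbf z|_{A_l^c},\qquad \Omega_h(\mathscr{A})=\frac1m\sum_{l=1}^mP_{l;h}.$$ **$N$-random sampling test of an operator $0\le\Omega\le I$.** Let $\rho$ be an arbitrary state (no i.i.d. assumption) on $N+1$ copies of the $n$-qubit system. Choose $N$ of the $N+1$ copies uniformly at random, apply the two-outcome POVM $\{\Omega,I-\Omega\}$ to each of them, and accept (the test is passed) iff all $N$ outcomes correspond to $\Omega$. When the test is passed, the resultant state $\sigma$ is the state of the remaining copy conditional on acceptance. Explicitly, writing $\Omega^{(i)}$ for the operator acting as $\Omega$ on every copy except the $i$-th and as $I$ on the $i$-th, the passing probability is $p(\rho)=\frac1{N+1}\sum_{i=1}^{N+1}\mathrm{Tr}[\Omega^{(i)}\rho]$, and $\mathrm{Tr}[\sigma X]=\frac{1}{p(\rho)(N+1)}\sum_{i=1}^{N+1}\mathrm{Tr}[\Omega^{(i)}X_i\,\rho]$ for every operator $X$ on a single copy, where $X_i$ is $X$ acting on the $i$-th copy. **Significance level.** A statement about $\sigma$ holds "with significance level $\beta$" if it holds for every $\rho$ with passing probability $p(\rho)\ge\beta$. *)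

theory Defs
  imports "HOL-Analysis.Analysis"
begin

section \<open>States and operators of composite systems\<close>

text \<open>
  A system with a finite type \<open>'s\<close> of computational basis labels has the Hilbert space
  \<open>complex ^ 's\<close>. If each site of a finite type \<open>'i\<close> carries one such system, then the basis labels of
  the tensor product are the functions \<open>'i \<Rightarrow> 's\<close>. This is used twice: \<open>n\<close> qubits have the basis
  \<open>'v \<Rightarrow> bool\<close> with \<open>CARD('v) = n\<close> (and \<open>False\<close>, \<open>True\<close> for the bits 0, 1), and \<open>N + 1\<close> copies of
  the \<open>n\<close>-qubit system have the basis \<open>'c \<Rightarrow> 'v \<Rightarrow> bool\<close> with \<open>CARD('c) = N + 1\<close>.
\<close>

definition cinner :: "complex ^ 's \<Rightarrow> complex ^ 's \<Rightarrow> complex" where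
  "cinner v w = (\<Sum>x\<in>UNIV. cnj (v $ x) * w $ x)"

definition ketbra :: "complex ^ 's \<Rightarrow> complex ^ 's \<Rightarrow> complex ^ 's ^ 's" where
  "ketbra v w = (\<chi> x y. v $ x * cnj (w $ y))"

definition tensor_vec :: "('i::finite \<Rightarrow> complex ^ 's) \<Rightarrow> complex ^ ('i \<Rightarrow> 's)" where
  "tensor_vec v = (\<chi> x. \<Prod>i\<in>UNIV. v i $ x i)"

definition tensor_op :: "('i::finite \<Rightarrow> complex ^ 's ^ 's) \<Rightarrow> complex ^ ('i \<Rightarrow> 's) ^ ('i \<Rightarrow> 's)" where
  "tensor_op A = (\<chi> x y. \<Prod>i\<in>UNIV. A i $ x i $ y i)"

definition at_site :: "'i::finite \<Rightarrow> complex ^ 's ^ 's \<Rightarrow> complex ^ ('i \<Rightarrow> 's) ^ ('i \<Rightarrow> 's)" where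
  "at_site i A = tensor_op (\<lambda>j. if j = i then A else mat 1)"

text \<open>Over the complex numbers, positivity of all expectation values entails that \<open>\<rho>\<close> is Hermitian.\<close>

definition density_operator :: "complex ^ 's ^ 's \<Rightarrow> bool" where
  "density_operator \<rho> \<longleftrightarrow> (\<forall>v. cinner v (\<rho> *v v) \<in> \<real>\<^sub>\<ge>\<^sub>0) \<and> trace \<rho> = 1"


section \<open>Weighted graph states\<close>

text \<open>
  The vertices \<open>1, \<dots>, n\<close> are the elements of a finite linearly ordered type. An edge is stored
  once, as the pair \<open>(j, k)\<close> with \<open>j < k\<close>. The diagonal values \<open>\<theta> j j\<close> are never used.
\<close>

definition weighted_graph ::
  "('v::{finite,linorder} \<times> 'v) set \<Rightarrow> ('v \<Rightarrow> 'v \<Rightarrow> real) \<Rightarrow> bool" where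
  "weighted_graph E \<theta> \<longleftrightarrow>
     (\<forall>(j, k)\<in>E. j < k) \<and>
     (\<forall>j k. \<theta> k j = \<theta> j k) \<and>
     (\<forall>j k. j < k \<longrightarrow> (j, k) \<notin> E \<longrightarrow> \<theta> j k = 0)"

definition ket :: "bool \<Rightarrow> complex ^ bool" where
  "ket b = axis b 1"

definition ket_plus :: "complex ^ bool" where
  "ket_plus = (1 / sqrt 2) *\<^sub>R (ket False + ket True)"

definition controlled_phase ::
  "'v \<Rightarrow> 'v \<Rightarrow> real \<Rightarrow> complex ^ ('v::finite \<Rightarrow> bool) ^ ('v \<Rightarrow> bool)" where
  "controlled_phase j k \<theta> =
     at_site j (ketbra (ket False) (ket False)) +
     at_site j (ketbra (ket True) (ket True)) **
       at_site k (ketbra (ket False) (ket False) + ketbra (cis \<theta> *s ket True) (ket True))"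

text \<open>
  The gates commute (see \<open>controlled_phase_commute\<close> below), so that the fold does not depend on the
  order in which the edges are taken.
\<close>

definition graph_state ::
  "('v \<times> 'v) set \<Rightarrow> ('v \<Rightarrow> 'v \<Rightarrow> real) \<Rightarrow> complex ^ ('v::finite \<Rightarrow> bool)" where
  "graph_state E \<theta> =
     Finite_Set.fold (\<lambda>(j, k) \<psi>. controlled_phase j k (\<theta> j k) *v \<psi>)
       (tensor_vec (\<lambda>_. ket_plus)) E"

lemma at_site_diagonal:
  fixes A :: "complex ^ 's ^ 's" and i :: "'i::finite"
  assumes "\<And>a b. a \<noteq> b \<Longrightarrow> A $ a $ b = 0" and "x \<noteq> y"
  shows "at_site i A $ x $ y = 0"
proof -
  obtain j where "x j \<noteq> y j"
    using \<open>x \<noteq> y\<close> by blast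
  then have "(if j = i then A else mat 1) $ x j $ y j = 0"
    using assms(1)[of "x j" "y j"] by (auto simp: mat_def)
  then have "\<exists>j\<in>UNIV. (if j = i then A else mat 1) $ x j $ y j = 0"
    by blast
  then show ?thesis
    by (simp add: at_site_def tensor_op_def)
qed

lemma diagonal_mult_vec:
  fixes D :: "complex ^ 's ^ 's"
  assumes "\<And>x y. x \<noteq> y \<Longrightarrow> D $ x $ y = 0"
  shows "(D *v \<psi>) $ x = D $ x $ x * \<psi> $ x"
proof -
  have "(D *v \<psi>) $ x = (\<Sum>y\<in>UNIV. if y = x then D $ x $ x * \<psi> $ x else 0)"
    unfolding matrix_vector_mult_def vec_lambda_beta
    by (intro sum.cong refl) (auto simp: assms)
  then show ?thesis
    by simp
qed

lemma diagonal_mult_diagonal: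
  fixes D D' :: "complex ^ 's ^ 's"
  assumes "\<And>x y. x \<noteq> y \<Longrightarrow> D $ x $ y = 0" and "\<And>x y. x \<noteq> y \<Longrightarrow> D' $ x $ y = 0"
    and "x \<noteq> y"
  shows "(D ** D') $ x $ y = 0"
proof -
  have "D $ x $ z * D' $ z $ y = 0" for z
    using assms by (cases "z = x") auto
  then show ?thesis
    unfolding matrix_matrix_mult_def vec_lambda_beta by (simp only: sum.neutral_const)
qed

lemma controlled_phase_diagonal:
  assumes "x \<noteq> y"
  shows "controlled_phase j k \<theta> $ x $ y = 0"
proof -
  have 1: "at_site i (ketbra (c *s ket b) (ket b)) $ x $ y = 0" if "x \<noteq> y" for i c b x y
    using that by (intro at_site_diagonal) (auto simp: ketbra_def ket_def axis_def)
  have 2: "at_site i (ketbra (ket b) (ket b)) $ x $ y = 0" if "x \<noteq> y" for i b x y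
    using 1[OF that, of i 1 b] by simp
  have 3: "at_site k (ketbra (ket False) (ket False) + ketbra (cis \<theta> *s ket True) (ket True)) $ x $ y = 0"
    if "x \<noteq> y" for x y
    using that by (intro at_site_diagonal) (auto simp: ketbra_def ket_def axis_def)
  show ?thesis
    using 2[OF assms] diagonal_mult_diagonal[OF 2 3 assms]
    by (simp add: controlled_phase_def)
qed

lemma controlled_phase_commute:
  "comp_fun_commute (\<lambda>(j, k) \<psi>. controlled_phase j k (\<theta> j k) *v \<psi>)"
proof -
  have *: "(controlled_phase j k t *v \<psi>) $ x = controlled_phase j k t $ x $ x * \<psi> $ x" for j k :: 'a and t \<psi> x
    by (rule diagonal_mult_vec) (rule controlled_phase_diagonal)
  show ?thesis
    by unfold_locales (auto simp: fun_eq_iff vec_eq_iff * mult.left_commute)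
qed


section \<open>Independence covers and the test operator\<close>

definition neighbours :: "('v \<times> 'v) set \<Rightarrow> 'v \<Rightarrow> 'v set" where
  "neighbours E k = {j. (j, k) \<in> E \<or> (k, j) \<in> E}"

definition independent_set :: "('v \<times> 'v) set \<Rightarrow> 'v set \<Rightarrow> bool" where
  "independent_set E A \<longleftrightarrow> (\<forall>k\<in>A. neighbours E k \<inter> A = {})"

definition independence_cover :: "('v \<times> 'v) set \<Rightarrow> 'v set set \<Rightarrow> bool" where
  "independence_cover E \<A> \<longleftrightarrow> partition_on UNIV \<A> \<and> (\<forall>A\<in>\<A>. independent_set E A)"

definition ket_angle :: "real \<Rightarrow> complex ^ bool" where
  "ket_angle \<alpha> = (1 / sqrt 2) *\<^sub>R (ket False + cis \<alpha> *s ket True)"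

definition local_angle ::
  "('v \<times> 'v) set \<Rightarrow> ('v \<Rightarrow> 'v \<Rightarrow> real) \<Rightarrow> 'v \<Rightarrow> ('v \<Rightarrow> bool) \<Rightarrow> real" where
  "local_angle E \<theta> k z = (\<Sum>j\<in>neighbours E k. \<theta> j k * of_bool (z j))"

definition rounded_angle :: "nat \<Rightarrow> real \<Rightarrow> real" where
  "rounded_angle h \<alpha> =
     of_int (THE t::int. of_int t * pi / h - pi / (2 * h) \<le> \<alpha> \<and>
                         \<alpha> < of_int t * pi / h + pi / (2 * h)) * pi / h"

text \<open>The bit strings on the complement of \<open>A\<close> are the extensional functions on \<open>- A\<close>.\<close>

definition local_test ::
  "('v \<times> 'v) set \<Rightarrow> ('v \<Rightarrow> 'v \<Rightarrow> real) \<Rightarrow> nat \<Rightarrow> 'v set \<Rightarrow>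
   complex ^ ('v::finite \<Rightarrow> bool) ^ ('v \<Rightarrow> bool)" where
  "local_test E \<theta> h A =
     (\<Sum>z \<in> (- A) \<rightarrow>\<^sub>E UNIV.
        tensor_op (\<lambda>k.
          if k \<in> A
          then let \<phi> = ket_angle (rounded_angle h (local_angle E \<theta> k z)) in ketbra \<phi> \<phi>
          else ketbra (ket (z k)) (ket (z k))))"

definition test_operator ::
  "('v \<times> 'v) set \<Rightarrow> ('v \<Rightarrow> 'v \<Rightarrow> real) \<Rightarrow> nat \<Rightarrow> 'v set set \<Rightarrow>
   complex ^ ('v::finite \<Rightarrow> bool) ^ ('v \<Rightarrow> bool)" where
  "test_operator E \<theta> h \<A> = (1 / real (card \<A>)) *\<^sub>R (\<Sum>A\<in>\<A>. local_test E \<theta> h A)"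

lemma rounded_angle_unique:
  assumes "h \<ge> 1"
  shows "\<exists>!t::int. of_int t * pi / real h - pi / (2 * real h) \<le> \<alpha> \<and>
                   \<alpha> < of_int t * pi / real h + pi / (2 * real h)"
proof -
  have "of_int t * pi / real h - pi / (2 * real h) \<le> \<alpha> \<and>
        \<alpha> < of_int t * pi / real h + pi / (2 * real h) \<longleftrightarrow>
        t = \<lfloor>\<alpha> * h / pi + 1 / 2\<rfloor>" (is "?L \<longleftrightarrow> _") for t
  proof -
    have "?L \<longleftrightarrow> of_int t \<le> \<alpha> * h / pi + 1 / 2 \<and> \<alpha> * h / pi + 1 / 2 < of_int t + 1"
      using assms by (auto simp: field_simps)
    then show ?thesis
      by (metis floor_eq_iff)
  qed
  then show ?thesis
    by simp
qed


section \<open>The random sampling test\<close>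

text \<open>
  All copies but the \<open>i\<close>-th are measured. The number \<open>N + 1\<close> of copies is \<open>CARD('c)\<close>.
\<close>

definition omit_copy ::
  "complex ^ 's ^ 's \<Rightarrow> 'c \<Rightarrow> complex ^ ('c::finite \<Rightarrow> 's) ^ ('c \<Rightarrow> 's)" where
  "omit_copy \<Omega> i = tensor_op (\<lambda>j. if j = i then mat 1 else \<Omega>)"

text \<open>
  For a test operator between 0 and the identity and a state \<open>\<rho>\<close>, the traces are real. \<open>Re\<close> only
  changes the type.
\<close>

definition passing_probability ::
  "complex ^ 's ^ 's \<Rightarrow> complex ^ ('c::finite \<Rightarrow> 's) ^ ('c \<Rightarrow> 's) \<Rightarrow> real" where
  "passing_probability \<Omega> \<rho> = (\<Sum>i\<in>UNIV. Re (trace (omit_copy \<Omega> i ** \<rho>))) / CARD('c)"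

text \<open>
  The state of the remaining copy is determined by its expectation values
  (see \<open>trace_resultant_state\<close> below).
\<close>

definition resultant_state ::
  "complex ^ 's ^ 's \<Rightarrow> complex ^ ('c::finite \<Rightarrow> 's) ^ ('c \<Rightarrow> 's) \<Rightarrow> complex ^ 's ^ 's" where
  "resultant_state \<Omega> \<rho> =
     (THE \<sigma>. \<forall>X. trace (\<sigma> ** X) =
        (\<Sum>i\<in>UNIV. trace (omit_copy \<Omega> i ** at_site i X ** \<rho>)) /
        complex_of_real (passing_probability \<Omega> \<rho> * CARD('c)))"

lemma at_site_sum:
  fixes X :: "complex ^ 's ^ 's" and i :: "'i::finite"
  shows "at_site i X = (\<Sum>a\<in>UNIV. \<Sum>b\<in>UNIV. \<chi> x y. X $ a $ b * at_site i (ketbra (axis a 1) (axis b 1)) $ x $ y)"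
proof -
  have *: "at_site i A $ x $ y = A $ x i $ y i * (\<Prod>j\<in>UNIV - {i}. mat 1 $ x j $ y j)"
    for A :: "complex ^ 's ^ 's" and x y
    by (simp add: at_site_def tensor_op_def prod.remove[of UNIV i])
  have "X $ a $ b = (\<Sum>a'\<in>UNIV. \<Sum>b'\<in>UNIV. X $ a' $ b' * ketbra (axis a' 1) (axis b' 1) $ a $ b)" for a b
  proof -
    have "(\<Sum>a'\<in>UNIV. \<Sum>b'\<in>UNIV. X $ a' $ b' * ketbra (axis a' 1) (axis b' 1) $ a $ b)
        = (\<Sum>a'\<in>UNIV. \<Sum>b'\<in>UNIV. if b' = b then if a' = a then X $ a $ b else 0 else 0)"
      by (intro sum.cong refl) (auto simp: ketbra_def axis_def)
    then show ?thesis
      by simp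
  qed
  then have entry: "at_site i X $ x $ y =
      (\<Sum>a\<in>UNIV. \<Sum>b\<in>UNIV. X $ a $ b * ketbra (axis a 1) (axis b 1) $ x i $ y i) *
      (\<Prod>j\<in>UNIV - {i}. mat 1 $ x j $ y j)" for x y
    by (metis *)
  have "at_site i X $ x $ y =
      (\<Sum>a\<in>UNIV. \<Sum>b\<in>UNIV. X $ a $ b * at_site i (ketbra (axis a 1) (axis b 1)) $ x $ y)" for x y
    unfolding entry *[of "ketbra _ _"] by (simp only: sum_distrib_right mult.assoc)
  then show ?thesis
    by (simp add: vec_eq_iff)
qed

lemma trace_resultant_state:
  fixes \<Omega> :: "complex ^ 's ^ 's" and \<rho> :: "complex ^ ('c::finite \<Rightarrow> 's) ^ ('c \<Rightarrow> 's)"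
  shows "trace (resultant_state \<Omega> \<rho> ** X) =
    (\<Sum>i\<in>UNIV. trace (omit_copy \<Omega> i ** at_site i X ** \<rho>)) /
    complex_of_real (passing_probability \<Omega> \<rho> * CARD('c))"
proof -
  define e :: "'s \<Rightarrow> 's \<Rightarrow> complex ^ 's ^ 's" where "e a b = ketbra (axis a 1) (axis b 1)" for a b
  define F where "F X = (\<Sum>i\<in>UNIV. trace (omit_copy \<Omega> i ** at_site i X ** \<rho>)) /
    complex_of_real (passing_probability \<Omega> \<rho> * CARD('c))" for X
  have unit: "trace (\<sigma> ** e a b) = \<sigma> $ b $ a" for \<sigma> a b
  proof -
    have "trace (\<sigma> ** e a b) = (\<Sum>x\<in>UNIV. \<Sum>y\<in>UNIV. if y = a then if x = b then \<sigma> $ b $ a else 0 else 0)"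
      unfolding trace_def matrix_matrix_mult_def e_def
      by (simp only: vec_lambda_beta, intro sum.cong refl) (auto simp: ketbra_def axis_def)
    then show ?thesis
      by simp
  qed
  have lin: "F X = (\<Sum>a\<in>UNIV. \<Sum>b\<in>UNIV. X $ a $ b * F (e a b))" for X
  proof -
    have "trace (omit_copy \<Omega> i ** at_site i X ** \<rho>) =
      (\<Sum>a\<in>UNIV. \<Sum>b\<in>UNIV. X $ a $ b * trace (omit_copy \<Omega> i ** at_site i (e a b) ** \<rho>))" for i
    proof -
      have tr: "trace (A ** B ** C) = (\<Sum>(x, y)\<in>UNIV. B $ x $ y * (C ** A) $ y $ x)"
        for A B C :: "complex ^ ('c \<Rightarrow> 's) ^ ('c \<Rightarrow> 's)"
      proof -
        have "trace (A ** B ** C) = trace (B ** (C ** A))"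
          by (metis matrix_mul_assoc trace_mul_sym)
        also have "\<dots> = (\<Sum>x\<in>UNIV. \<Sum>y\<in>UNIV. B $ x $ y * (C ** A) $ y $ x)"
          by (simp add: trace_def matrix_matrix_mult_def[of B])
        also have "\<dots> = (\<Sum>(x, y)\<in>UNIV. B $ x $ y * (C ** A) $ y $ x)"
          by (simp add: sum.cartesian_product)
        finally show ?thesis .
      qed
      have "at_site i X $ x $ y = (\<Sum>a\<in>UNIV. \<Sum>b\<in>UNIV. X $ a $ b * at_site i (e a b) $ x $ y)" for x y
        by (subst at_site_sum) (simp add: e_def)
      then have "trace (omit_copy \<Omega> i ** at_site i X ** \<rho>) =
        (\<Sum>p\<in>UNIV. \<Sum>a\<in>UNIV. \<Sum>b\<in>UNIV.
           X $ a $ b * (at_site i (e a b) $ fst p $ snd p * (\<rho> ** omit_copy \<Omega> i) $ snd p $ fst p))"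
        by (simp add: tr case_prod_unfold sum_distrib_right mult.assoc)
      also have "\<dots> = (\<Sum>a\<in>UNIV. \<Sum>p\<in>UNIV. \<Sum>b\<in>UNIV.
           X $ a $ b * (at_site i (e a b) $ fst p $ snd p * (\<rho> ** omit_copy \<Omega> i) $ snd p $ fst p))"
        by (rule sum.swap)
      also have "\<dots> = (\<Sum>a\<in>UNIV. \<Sum>b\<in>UNIV. \<Sum>p\<in>UNIV.
           X $ a $ b * (at_site i (e a b) $ fst p $ snd p * (\<rho> ** omit_copy \<Omega> i) $ snd p $ fst p))"
        by (intro sum.cong refl sum.swap)
      finally show ?thesis
        by (simp add: tr case_prod_unfold sum_distrib_left)
    qed
    then have "(\<Sum>i\<in>UNIV. trace (omit_copy \<Omega> i ** at_site i X ** \<rho>)) =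
      (\<Sum>i\<in>UNIV. \<Sum>a\<in>UNIV. \<Sum>b\<in>UNIV. X $ a $ b * trace (omit_copy \<Omega> i ** at_site i (e a b) ** \<rho>))"
      by simp
    also have "\<dots> = (\<Sum>a\<in>UNIV. \<Sum>i\<in>UNIV. \<Sum>b\<in>UNIV.
        X $ a $ b * trace (omit_copy \<Omega> i ** at_site i (e a b) ** \<rho>))"
      by (rule sum.swap)
    also have "\<dots> = (\<Sum>a\<in>UNIV. \<Sum>b\<in>UNIV. \<Sum>i\<in>UNIV.
        X $ a $ b * trace (omit_copy \<Omega> i ** at_site i (e a b) ** \<rho>))"
      by (intro sum.cong refl sum.swap)
    finally show ?thesis
      by (simp add: F_def sum_distrib_left sum_divide_distrib)
  qed
  define \<sigma> where "\<sigma> = (\<chi> b a. F (e a b))"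
  have "\<forall>X. trace (\<sigma> ** X) = F X"
  proof
    fix X
    have "trace (\<sigma> ** X) = (\<Sum>b\<in>UNIV. \<Sum>a\<in>UNIV. X $ a $ b * F (e a b))"
      by (simp add: trace_def matrix_matrix_mult_def \<sigma>_def mult.commute)
    also have "\<dots> = F X"
      by (subst lin) (rule sum.swap)
    finally show "trace (\<sigma> ** X) = F X" .
  qed
  moreover have "\<tau> = \<sigma>" if "\<forall>X. trace (\<tau> ** X) = F X" for \<tau>
    using that unit[of \<tau>] by (simp add: vec_eq_iff \<sigma>_def)
  ultimately have "\<forall>X. trace ((THE \<sigma>. \<forall>X. trace (\<sigma> ** X) = F X) ** X) = F X"
    by (rule theI)
  then show ?thesis
    by (simp only: resultant_state_def F_def)
qed

end

theory Submission
  imports Defs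
begin

text \<open>
  Completeness. In every block of fixed bits off \<open>A\<close>, the graph state and the test agree up to the
  rounding of the angles, so that the overlap is a product of \<open>cos\<^sup>2\<close> of half rounding errors.

  Soundness. In each slot \<open>I = \<Omega> + (I - \<Omega>)\<close>, and expanding the product shows that
  \<open>\<Sum>\<^sub>i \<Omega>\<^sup>(\<^sup>i\<^sup>) \<le> I + N \<Omega>\<^sup>\<otimes>\<^sup>(\<^sup>N\<^sup>+\<^sup>1\<^sup>)\<close>. This gives \<open>Tr \<sigma>\<Omega> \<ge> 1 - (1 - \<beta>) / (\<beta>N)\<close> for every test \<open>\<Omega>\<close>.
  A test \<open>P\<^sub>l\<^sub>;\<^sub>h\<close> exceeds the test \<open>P\<^sub>l\<close> with the exact angles by at most \<open>|A\<^sub>l| sin (\<pi> / 4h)\<close>, since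
  replacing one angle at a time changes one projection by a matrix of norm \<open>\<bar>sin\<bar>\<close> of half the error.
  The edge phases turn \<open>P\<^sub>l\<close> into the projection onto \<open>|+\<rangle>\<close> on all sites of \<open>A\<^sub>l\<close>, and expanding
  \<open>I = |+\<rangle>\<langle>+| + |-\<rangle>\<langle>-|\<close> on every site gives \<open>\<Sum>\<^sub>l (I - P\<^sub>l) \<ge> I - |G\<rangle>\<langle>G|\<close>.
  Operator inequalities are witnessed by sums of rank-one projections, for which positivity of tensor
  products follows from multilinearity.
\<close>

section \<open>Sums of rank-one projections\<close>

text \<open>By the spectral theorem this is the cone of all positive semidefinite matrices.
  Generating it from unnormalised rank-one terms gives an induction that reduces additive claims to
  a single \<open>ketbra v v\<close>.\<close>

inductive psd :: "complex ^ 's ^ 's \<Rightarrow> bool" where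
  zero: "psd 0"
| add_ketbra: "psd A \<Longrightarrow> psd (A + ketbra v v)"

lemma psd_ketbra: "psd (ketbra v v)"
  using psd.add_ketbra[OF psd.zero] by simp

lemma psd_add:
  assumes "psd A" and "psd B"
  shows "psd (A + B)"
  using assms(2) by induction (auto simp: assms(1) add.assoc[symmetric] intro: psd.add_ketbra)

lemma psd_scaleR:
  assumes "psd A" and "r \<ge> 0"
  shows "psd (r *\<^sub>R A)"
  using assms(1)
proof induction
  case (add_ketbra A v)
  have "r *\<^sub>R ketbra v v = ketbra (sqrt r *\<^sub>R v) (sqrt r *\<^sub>R v)"
    using \<open>r \<ge> 0\<close> by (simp add: ketbra_def vec_eq_iff)
  then show ?case
    using add_ketbra by (simp add: scaleR_add_right psd.add_ketbra)
qed (simp add: psd.zero)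

lemma psd_sum:
  assumes "\<And>a. a \<in> S \<Longrightarrow> psd (F a)"
  shows "psd (sum F S)"
  using assms by (induction S rule: infinite_finite_induct) (auto intro: psd.zero psd_add)

lemma mat_1_eq_sum_ketbra: "(mat 1 :: complex ^ 's ^ 's) = (\<Sum>a\<in>UNIV. ketbra (axis a 1) (axis a 1))"
proof -
  have "(\<Sum>a\<in>UNIV. ketbra (axis a 1) (axis a 1)) $ x $ y = (mat 1 :: complex ^ 's ^ 's) $ x $ y"
    for x y
  proof -
    have "(\<Sum>a\<in>UNIV. ketbra (axis a 1) (axis a 1)) $ x $ y
      = (\<Sum>a\<in>UNIV. if a = x then (if x = y then 1 else 0 :: complex) else 0)"
      unfolding sum_component by (intro sum.cong refl) (auto simp: ketbra_def axis_def)
    then show ?thesis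
      by (simp add: mat_def)
  qed
  then show ?thesis
    by (simp add: vec_eq_iff)
qed

lemma psd_mat_1: "psd (mat 1)"
  unfolding mat_1_eq_sum_ketbra by (intro psd_sum psd_ketbra)

text \<open>This is conjugation by the diagonal matrix with entries \<open>u\<close>, which keeps a
  generator rank one. It serves to apply the edge phases to an operator inequality.\<close>

lemma psd_diagonal_conjugate:
  assumes "psd A"
  shows "psd (\<chi> x y. u x * A $ x $ y * cnj (u y))"
  using assms
proof induction
  case (add_ketbra A v)
  have "(\<chi> x y. u x * (A + ketbra v v) $ x $ y * cnj (u y)) =
    (\<chi> x y. u x * A $ x $ y * cnj (u y)) + ketbra (\<chi> x. u x * v $ x) (\<chi> x. u x * v $ x)"
    by (simp add: vec_eq_iff ketbra_def algebra_simps)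
  then show ?case
    using add_ketbra by (simp add: psd.add_ketbra)
next
  case zero
  have "(\<chi> x y. u x * (0 :: complex ^ 'a ^ 'a) $ x $ y * cnj (u y)) = 0"
    by (simp add: vec_eq_iff)
  then show ?case
    by (simp add: psd.zero)
qed

lemma cinner_eq_trace: "trace (A ** ketbra v v) = cinner v (A *v v)"
proof -
  have "trace (A ** ketbra v v) = (\<Sum>x\<in>UNIV. \<Sum>y\<in>UNIV. A $ x $ y * (v $ y * cnj (v $ x)))"
    by (simp add: trace_def matrix_matrix_mult_def ketbra_def)
  also have "\<dots> = cinner v (A *v v)"
    by (simp add: cinner_def matrix_vector_mult_def sum_distrib_left mult_ac)
  finally show ?thesis .
qed

text \<open>On a generator the trace is an expectation value of \<open>\<rho>\<close>. Operator
  inequalities thereby turn into inequalities for states.\<close>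

lemma trace_mult_psd_nonneg:
  assumes "psd A" and "\<And>v. Re (cinner v (\<rho> *v v)) \<ge> 0"
  shows "Re (trace (\<rho> ** A)) \<ge> 0"
  using assms(1)
proof induction
  case (add_ketbra A v)
  then show ?case
    using assms(2)[of v] by (simp only: matrix_add_ldistrib trace_add cinner_eq_trace plus_complex.sel)
qed (simp add: trace_def)


section \<open>Tensor products\<close>

lemma tensor_op_fun_upd:
  "tensor_op (A(i := X)) = (\<chi> x y. X $ x i $ y i * (\<Prod>j\<in>UNIV - {i}. A j $ x j $ y j))"
  by (simp add: tensor_op_def prod.remove[of UNIV i] vec_eq_iff)

lemma tensor_op_add: "tensor_op (A(i := X + Y)) = tensor_op (A(i := X)) + tensor_op (A(i := Y))"
  by (simp add: tensor_op_fun_upd vec_eq_iff distrib_right)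

lemma tensor_op_diff: "tensor_op (A(i := X - Y)) = tensor_op (A(i := X)) - tensor_op (A(i := Y))"
  by (simp add: tensor_op_fun_upd vec_eq_iff left_diff_distrib)

lemma tensor_op_scaleR: "tensor_op (A(i := r *\<^sub>R X)) = r *\<^sub>R tensor_op (A(i := X))"
  by (simp add: tensor_op_fun_upd vec_eq_iff)

lemma tensor_op_eq_0: "A i = 0 \<Longrightarrow> tensor_op A = 0"
  by (auto simp: tensor_op_def vec_eq_iff intro!: exI[of _ i])

lemma tensor_op_ketbra:
  "tensor_op (\<lambda>i. ketbra (v i) (w i)) = ketbra (tensor_vec v) (tensor_vec w)"
  by (simp add: tensor_op_def ketbra_def tensor_vec_def vec_eq_iff prod.distrib)

lemma tensor_op_mat_1: "tensor_op (\<lambda>_. mat 1) = mat 1"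
  by (auto simp: tensor_op_def mat_def vec_eq_iff fun_eq_iff)

lemma prod_UNIV_sum_UNIV:
  fixes f :: "'i::finite \<Rightarrow> 's::finite \<Rightarrow> complex"
  shows "(\<Prod>i\<in>UNIV. \<Sum>a\<in>UNIV. f i a) = (\<Sum>x\<in>UNIV. \<Prod>i\<in>UNIV. f i (x i))"
  by (subst prod_sum_PiE) auto

lemma tensor_op_mult: "tensor_op A ** tensor_op B = tensor_op (\<lambda>i. A i ** B i)"
  by (simp add: tensor_op_def matrix_matrix_mult_def vec_eq_iff prod_UNIV_sum_UNIV prod.distrib)

lemma tensor_op_mult_vec: "tensor_op A *v tensor_vec v = tensor_vec (\<lambda>i. A i *v v i)"
  by (simp add: tensor_op_def tensor_vec_def matrix_vector_mult_def vec_eq_iff prod_UNIV_sum_UNIV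
      prod.distrib)

lemma cinner_tensor_vec: "cinner (tensor_vec v) (tensor_vec w) = (\<Prod>i\<in>UNIV. cinner (v i) (w i))"
  by (simp add: cinner_def tensor_vec_def prod_UNIV_sum_UNIV prod.distrib)

text \<open>\<open>S\<close> records the slots in which the first summand is picked. When all
  summands are positive, so is every term, and inequalities reduce to comparing which sets
  \<open>S\<close> occur.\<close>

lemma tensor_op_expand:
  "tensor_op (\<lambda>i. A i + B i) = (\<Sum>S\<in>UNIV. tensor_op (\<lambda>i. if i \<in> S then A i else B i))"
proof -
  have "(\<Prod>i\<in>UNIV. A i $ x i $ y i + B i $ x i $ y i)
      = (\<Sum>S\<in>UNIV. \<Prod>i\<in>UNIV. (if i \<in> S then A i else B i) $ x i $ y i)" for x y
  proof -
    have "(\<Prod>i\<in>UNIV. A i $ x i $ y i + B i $ x i $ y i)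
        = (\<Sum>S\<in>Pow UNIV. (\<Prod>i\<in>S. A i $ x i $ y i) * (\<Prod>i\<in>UNIV - S. B i $ x i $ y i))"
      by (rule prod_add) simp
    also have "\<dots> = (\<Sum>S\<in>UNIV. \<Prod>i\<in>UNIV. (if i \<in> S then A i else B i) $ x i $ y i)"
    proof (intro sum.cong)
      fix S :: "'a set"
      have "(\<Prod>i\<in>UNIV. (if i \<in> S then A i else B i) $ x i $ y i)
        = (\<Prod>i\<in>S. (if i \<in> S then A i else B i) $ x i $ y i)
          * (\<Prod>i\<in>UNIV - S. (if i \<in> S then A i else B i) $ x i $ y i)"
        by (simp add: prod.subset_diff[of S UNIV] mult.commute)
      then show "(\<Prod>i\<in>S. A i $ x i $ y i) * (\<Prod>i\<in>UNIV - S. B i $ x i $ y i)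
          = (\<Prod>i\<in>UNIV. (if i \<in> S then A i else B i) $ x i $ y i)"
        by simp
    qed simp
    finally show ?thesis .
  qed
  then show ?thesis
    by (simp add: tensor_op_def vec_eq_iff)
qed

text \<open>A tensor product of rank-one terms \<open>ketbra v v\<close> is again such a term;
  multilinearity reduces the general case to this one, slot by slot.\<close>

lemma psd_tensor_op:
  fixes A :: "'i::finite \<Rightarrow> complex ^ 's ^ 's"
  assumes "\<And>i. psd (A i)"
  shows "psd (tensor_op A)"
proof -
  \<comment> \<open>\<open>S\<close> holds the slots that have not yet been reduced to a single
    \<open>ketbra v v\<close>.\<close>
  have "psd (tensor_op A)" if "finite S" "\<And>i. i \<in> S \<Longrightarrow> psd (A i)" "\<And>i. i \<notin> S \<Longrightarrow> \<exists>v. A i = ketbra v v"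
    for S and A :: "'i \<Rightarrow> complex ^ 's ^ 's"
    using that
  proof (induction S arbitrary: A)
    case empty
    then obtain v where "\<And>i. A i = ketbra (v i) (v i)"
      by (metis empty_iff)
    then have "A = (\<lambda>i. ketbra (v i) (v i))"
      by blast
    then show ?case
      by (simp add: tensor_op_ketbra psd_ketbra)
  next
    case (insert i S)
    have "psd (tensor_op (A(i := X)))" if "psd X" for X
      using that
    proof induction
      case (add_ketbra X v)
      \<comment> \<open>Slot \<open>i\<close> is now rank one, so the outer hypothesis for
        \<open>S\<close> applies.\<close>
      have "psd (tensor_op (A(i := ketbra v v)))"
        by (rule insert.IH) (use insert.prems insert.hyps in auto)
      then show ?case
        using add_ketbra by (simp only: tensor_op_add psd_add)
    qed (simp add: tensor_op_eq_0[of _ i] psd.zero)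
    then show ?case
      using insert.prems(1)[of i] by (metis fun_upd_triv insertI1)
  qed
  from this[of UNIV A] show ?thesis
    using assms by simp
qed

text \<open>Expand each \<open>B i\<close> as \<open>A i\<close> plus the positive rest
  \<open>B i - A i\<close>. The set \<open>S = UNIV\<close> yields \<open>tensor_op A\<close>, and
  all other terms are positive.\<close>

lemma psd_tensor_op_mono:
  assumes "\<And>i. psd (A i)" and "\<And>i. psd (B i - A i)"
  shows "psd (tensor_op B - tensor_op A)"
proof -
  have "tensor_op B = (\<Sum>S\<in>UNIV. tensor_op (\<lambda>i. if i \<in> S then A i else B i - A i))"
    using tensor_op_expand[of A "\<lambda>i. B i - A i"] by simp
  also have "\<dots> = tensor_op A + (\<Sum>S\<in>-{UNIV}. tensor_op (\<lambda>i. if i \<in> S then A i else B i - A i))"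
    by (subst sum.remove[of _ UNIV]) (auto simp: Compl_eq_Diff_UNIV)
  finally show ?thesis
    by (simp add: assms psd_sum psd_tensor_op)
qed

text \<open>Replacing the slots of \<open>S\<close> one after another gives a telescoping sum. Each
  replacement costs \<open>s\<close> times a product with \<open>B i\<close> in one slot, which lies
  below \<open>s\<close> times \<open>tensor_op B\<close>.\<close>

lemma psd_tensor_op_perturb:
  assumes "\<And>i. psd (A i)" "\<And>i. psd (A' i)" "\<And>i. psd (B i - A i)" "\<And>i. psd (B i - A' i)"
    and "\<And>i. i \<in> S \<Longrightarrow> psd (s *\<^sub>R B i - (A i - A' i))" and "\<And>i. i \<notin> S \<Longrightarrow> A i = A' i"
    and "s \<ge> 0"
  shows "psd ((real (card S) * s) *\<^sub>R tensor_op B - (tensor_op A - tensor_op A'))"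
proof -
  have "finite S"
    by simp
  then show ?thesis
    using assms
  proof (induction S arbitrary: A')
    case empty
    then have "A = A'"
      by auto
    then show ?case
      by (simp add: psd.zero)
  next
    case (insert i S)
    \<comment> \<open>The intermediate product: it agrees with \<open>A\<close> off
      \<open>S\<close>, and passing on to \<open>A'\<close> changes slot \<open>i\<close>
      alone.\<close>
    define A'' where "A'' = A'(i := A i)"
    have 1: "psd ((real (card S) * s) *\<^sub>R tensor_op B - (tensor_op A - tensor_op A''))"
      by (rule insert.IH) (use insert in \<open>auto simp: A''_def\<close>)
    have psdB: "psd (B j)" for j
      using psd_add[OF insert.prems(1)[of j] insert.prems(3)[of j]] by simp
    have "psd (tensor_op (A'(i := s *\<^sub>R B i - (A i - A' i))))"
      by (rule psd_tensor_op) (use insert.prems in auto)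
    then have 2: "psd (s *\<^sub>R tensor_op (A'(i := B i)) - (tensor_op A'' - tensor_op A'))"
      by (simp only: tensor_op_diff tensor_op_scaleR A''_def fun_upd_triv)
    have "psd (tensor_op B - tensor_op (A'(i := B i)))"
      by (rule psd_tensor_op_mono) (use insert.prems psdB in \<open>auto simp: psd.zero\<close>)
    then have 3: "psd (s *\<^sub>R (tensor_op B - tensor_op (A'(i := B i))))"
      using \<open>s \<ge> 0\<close> by (rule psd_scaleR)
    have "(real (card (insert i S)) * s) *\<^sub>R tensor_op B - (tensor_op A - tensor_op A') =
      ((real (card S) * s) *\<^sub>R tensor_op B - (tensor_op A - tensor_op A'')) +
      (s *\<^sub>R tensor_op (A'(i := B i)) - (tensor_op A'' - tensor_op A')) +
      s *\<^sub>R (tensor_op B - tensor_op (A'(i := B i)))"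
      using insert.hyps by (simp add: algebra_simps)
    then show ?case
      using psd_add[OF psd_add[OF 1 2] 3] by (simp only:)
  qed
qed


section \<open>Random sampling\<close>

lemma trace_sum: "trace (\<Sum>a\<in>S. F a) = (\<Sum>a\<in>S. trace (F a))"
  unfolding trace_def sum_component by (rule sum.swap)

lemma trace_scaleR: "trace (r *\<^sub>R A) = r *\<^sub>R trace A"
  by (simp add: trace_def scaleR_sum_right)

lemma matrix_mult_scaleR_right: "A ** (r *\<^sub>R B) = r *\<^sub>R (A ** B)"
  for A :: "complex ^ 'n ^ 'm"
  by (simp add: matrix_matrix_mult_def vec_eq_iff scaleR_sum_right)

lemma matrix_mult_sum_right: "A ** (\<Sum>a\<in>S. F a) = (\<Sum>a\<in>S. A ** F a)"
  for A :: "complex ^ 'n ^ 'm"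
  by (induction S rule: infinite_finite_induct) (simp_all add: matrix_add_ldistrib)

lemma Re_trace_mult_scaleR: "Re (trace (\<rho> ** (r *\<^sub>R A))) = r * Re (trace (\<rho> ** A))"
  for \<rho> :: "complex ^ 's ^ 's"
  by (simp only: matrix_mult_scaleR_right trace_scaleR scaleR_complex.sel)

lemma Re_trace_mult_add: "Re (trace (\<rho> ** (A + B))) = Re (trace (\<rho> ** A)) + Re (trace (\<rho> ** B))"
  for \<rho> :: "complex ^ 's ^ 's"
  by (simp only: matrix_add_ldistrib trace_add plus_complex.sel)

lemma Re_trace_mult_diff: "Re (trace (\<rho> ** (A - B))) = Re (trace (\<rho> ** A)) - Re (trace (\<rho> ** B))"
  for \<rho> :: "complex ^ 's ^ 's"
  using Re_trace_mult_add[of \<rho> "A - B" B] by simp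

lemma Re_trace_mult_sum: "Re (trace (\<rho> ** (\<Sum>a\<in>S. F a))) = (\<Sum>a\<in>S. Re (trace (\<rho> ** F a)))"
  for \<rho> :: "complex ^ 's ^ 's"
  by (simp only: matrix_mult_sum_right trace_sum Re_sum)

lemma omit_copy_at_site:
  "omit_copy \<Omega> i ** at_site i X = tensor_op (\<lambda>j. if j = i then X else \<Omega>)"
  unfolding omit_copy_def at_site_def tensor_op_mult by (intro arg_cong[of _ _ tensor_op]) auto

text \<open>
  Expand every factor of the identity as \<open>\<Omega> + (1 - \<Omega>)\<close>. The left-hand side is the sum of the
  products with at least two factors \<open>1 - \<Omega>\<close>.
\<close>

lemma psd_sampling:
  fixes \<Omega> :: "complex ^ 's ^ 's"
  assumes "psd \<Omega>" and "psd (mat 1 - \<Omega>)" and "CARD('c::finite) = N + 1"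
  shows "psd (mat 1 + real N *\<^sub>R tensor_op (\<lambda>_::'c. \<Omega>) - (\<Sum>i::'c\<in>UNIV. omit_copy \<Omega> i))"
proof -
  define T where "T S = tensor_op (\<lambda>i::'c. if i \<in> S then \<Omega> else mat 1 - \<Omega>)" for S
  \<comment> \<open>The index sets with exactly one factor \<open>mat 1 - \<Omega>\<close>.\<close>
  define \<S> where "\<S> = range (\<lambda>i::'c. UNIV - {i})"
  have 1: "mat 1 = (\<Sum>S\<in>UNIV. T S)"
    using tensor_op_expand[of "\<lambda>_::'c. \<Omega>" "\<lambda>_. mat 1 - \<Omega>"] by (simp add: T_def tensor_op_mat_1)
  have omit: "omit_copy \<Omega> i = T UNIV + T (UNIV - {i})" for i
  proof -
    have "omit_copy \<Omega> i = tensor_op ((\<lambda>_. \<Omega>)(i := \<Omega> + (mat 1 - \<Omega>)))"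
      unfolding omit_copy_def by (intro arg_cong[of _ _ tensor_op]) auto
    also have "\<dots> = tensor_op ((\<lambda>_. \<Omega>)(i := \<Omega>)) + tensor_op ((\<lambda>_. \<Omega>)(i := mat 1 - \<Omega>))"
      by (rule tensor_op_add)
    also have "\<dots> = T UNIV + T (UNIV - {i})"
      unfolding T_def by (intro arg_cong2[of _ _ _ _ "(+)"] arg_cong[of _ _ tensor_op]) auto
    finally show ?thesis .
  qed
  have inj: "inj (\<lambda>i::'c. UNIV - {i})"
    by (auto simp: inj_on_def)
  \<comment> \<open>Each of the \<open>N + 1\<close> omissions contains \<open>T UNIV\<close>. The
    identity supplies one of these, which is why the claim adds \<open>real N\<close> times
    \<open>tensor_op\<close>.\<close>
  have "(\<Sum>i::'c\<in>UNIV. omit_copy \<Omega> i) = real (N + 1) *\<^sub>R T UNIV + (\<Sum>S\<in>\<S>. T S)"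
    unfolding omit sum.distrib \<S>_def sum.reindex[OF inj]
    by (simp only: sum_constant_scaleR assms(3) o_def)
  moreover have "mat 1 = (\<Sum>S\<in>UNIV - \<S> - {UNIV}. T S) + (T UNIV + (\<Sum>S\<in>\<S>. T S))"
  proof -
    have "UNIV \<notin> \<S>"
      by (auto simp: \<S>_def)
    then have "(\<Sum>S\<in>UNIV - \<S>. T S) = T UNIV + (\<Sum>S\<in>UNIV - \<S> - {UNIV}. T S)"
      by (intro sum.remove) auto
    then show ?thesis
      unfolding 1 by (subst sum.subset_diff[of \<S>]) (auto simp: algebra_simps)
  qed
  ultimately have "mat 1 + real N *\<^sub>R tensor_op (\<lambda>_::'c. \<Omega>) - (\<Sum>i::'c\<in>UNIV. omit_copy \<Omega> i)
      = (\<Sum>S\<in>UNIV - \<S> - {UNIV}. T S)"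
    by (simp add: T_def algebra_simps)
  moreover have "psd (T S)" for S
    unfolding T_def by (rule psd_tensor_op) (simp add: assms)
  ultimately show ?thesis
    by (simp add: psd_sum)
qed

section \<open>Expectation values in the resultant state\<close>

lemma density_operator_nonneg: "density_operator \<rho> \<Longrightarrow> Re (cinner v (\<rho> *v v)) \<ge> 0"
  unfolding density_operator_def by (metis complex_nonneg_Reals_iff)

lemma Re_trace_resultant_state:
  fixes \<Omega> :: "complex ^ 's ^ 's" and \<rho> :: "complex ^ ('c::finite \<Rightarrow> 's) ^ ('c \<Rightarrow> 's)"
  shows "Re (trace (resultant_state \<Omega> \<rho> ** X)) =
    (\<Sum>i\<in>UNIV. Re (trace (\<rho> ** tensor_op (\<lambda>j. if j = i then X else \<Omega>)))) /
    (passing_probability \<Omega> \<rho> * CARD('c))"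
  unfolding trace_resultant_state omit_copy_at_site Re_divide_of_real Re_sum
  by (simp only: trace_mul_sym[of _ \<rho>])

lemma passing_probability_eq:
  "passing_probability \<Omega> \<rho> = (\<Sum>i\<in>UNIV. Re (trace (\<rho> ** omit_copy \<Omega> i))) / CARD('c)"
  for \<rho> :: "complex ^ ('c::finite \<Rightarrow> 's::finite) ^ ('c \<Rightarrow> 's)"
  unfolding passing_probability_def by (simp only: trace_mul_sym[of _ \<rho>])

lemma Re_trace_resultant_state_psd:
  fixes \<Omega> :: "complex ^ 's ^ 's" and \<rho> :: "complex ^ ('c::finite \<Rightarrow> 's) ^ ('c \<Rightarrow> 's)"
  assumes "density_operator \<rho>" and "psd \<Omega>" and "psd X" and "passing_probability \<Omega> \<rho> > 0"
  shows "Re (trace (resultant_state \<Omega> \<rho> ** X)) \<ge> 0"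
proof -
  have "Re (trace (\<rho> ** tensor_op (\<lambda>j. if j = i then X else \<Omega>))) \<ge> 0" for i
    by (intro trace_mult_psd_nonneg psd_tensor_op density_operator_nonneg) (simp_all add: assms)
  then show ?thesis
    unfolding Re_trace_resultant_state using assms(4) by (simp add: sum_nonneg)
qed

lemma Re_trace_resultant_state_mat_1:
  assumes "passing_probability \<Omega> \<rho> > 0"
  shows "Re (trace (resultant_state \<Omega> \<rho> ** mat 1)) = 1"
  using assms
  unfolding Re_trace_resultant_state omit_copy_def[symmetric] passing_probability_eq by (auto simp: zero_less_divide_iff)

text \<open>Let \<open>p\<close> be the passing probability and \<open>q\<close> the probability
  that all \<open>N + 1\<close> copies pass. The left-hand side is \<open>q / p\<close>, and
  \<open>psd_sampling\<close> gives \<open>p * (N + 1) <= 1 + N * q\<close>. The resulting bound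
  \<open>1 - (1 - p) / (p * N)\<close> increases with \<open>p\<close>, which allows
  \<open>\<beta>\<close> in its place.\<close>

lemma Re_trace_resultant_state_test:
  fixes \<Omega> :: "complex ^ 's ^ 's" and \<rho> :: "complex ^ ('c::finite \<Rightarrow> 's) ^ ('c \<Rightarrow> 's)"
  assumes "density_operator \<rho>" and "psd \<Omega>" and "psd (mat 1 - \<Omega>)"
    and N: "CARD('c) = N + 1" "N \<ge> 1"
    and \<beta>: "passing_probability \<Omega> \<rho> \<ge> \<beta>" "\<beta> > 0"
  shows "Re (trace (resultant_state \<Omega> \<rho> ** \<Omega>)) \<ge> 1 - (1 - \<beta>) / (\<beta> * real N)"
proof -
  define p where "p = passing_probability \<Omega> \<rho>"
  define q where "q = Re (trace (\<rho> ** tensor_op (\<lambda>_. \<Omega>)))"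
  have "p > 0"
    using \<beta> by (simp add: p_def)
  have tr: "Re (trace (\<rho> ** mat 1)) = 1"
    using assms(1) by (simp add: density_operator_def)
  have "0 \<le> Re (trace (\<rho> ** (mat 1 + real N *\<^sub>R tensor_op (\<lambda>_::'c. \<Omega>) - (\<Sum>i::'c\<in>UNIV. omit_copy \<Omega> i))))"
    by (intro trace_mult_psd_nonneg psd_sampling density_operator_nonneg assms)
  also have "\<dots> = 1 + real N * q - p * real CARD('c)"
    unfolding Re_trace_mult_diff Re_trace_mult_add Re_trace_mult_scaleR
      Re_trace_mult_sum tr by (simp add: p_def q_def passing_probability_eq)
  finally have ineq: "p * (real N + 1) \<le> 1 + real N * q"
    by (simp add: N add.commute)
  have "(1 - p) / p \<le> (1 - \<beta>) / \<beta>"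
    using \<beta> \<open>p > 0\<close> by (simp add: p_def field_simps)
  then have "(1 - p) / p / real N \<le> (1 - \<beta>) / \<beta> / real N"
    by (rule divide_right_mono) simp
  then have "1 - (1 - \<beta>) / (\<beta> * real N) \<le> 1 - (1 - p) / (p * real N)"
    by simp
  also have "\<dots> = (p * (real N + 1) - 1) / (p * real N)"
    using N \<open>p > 0\<close> by (simp add: field_simps)
  also have "\<dots> \<le> q / p"
  proof -
    have "(p * (real N + 1) - 1) / real N \<le> q"
      using ineq N by (simp add: field_simps)
    then have "(p * (real N + 1) - 1) / real N / p \<le> q / p"
      by (rule divide_right_mono) (use \<open>p > 0\<close> in simp)
    then show ?thesis
      by (simp add: mult.commute)
  qed
  \<comment> \<open>Measuring the remaining copy with \<open>\<Omega>\<close> as well makes every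
    term of the sum over the copies equal to \<open>q\<close>.\<close>
  also have "q / p = Re (trace (resultant_state \<Omega> \<rho> ** \<Omega>))"
    unfolding Re_trace_resultant_state by (simp add: p_def q_def)
  finally show ?thesis .
qed


section \<open>Local tests\<close>

lemma ket_nth: "ket b $ c = of_bool (c = b)"
  by (simp add: ket_def axis_def)

lemma ket_angle_nth: "ket_angle \<alpha> $ b = of_real (1 / sqrt 2) * (if b then cis \<alpha> else 1)"
  unfolding ket_angle_def vector_scaleR_component by (simp add: ket_nth scaleR_conv_of_real)

lemma ketbra_ket_angle_nth:
  "ketbra (ket_angle \<alpha>) (ket_angle \<alpha>) $ b $ c = (if b = c then 1 else if b then cis \<alpha> else cis (- \<alpha>)) / 2"
proof -
  have "complex_of_real (sqrt 2) * complex_of_real (sqrt 2) = 2"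
    by (simp flip: of_real_mult)
  then show ?thesis
    by (auto simp: ketbra_def ket_angle_nth cis_cnj cis_mult)
qed

text \<open>The state orthogonal to an equatorial one is its antipode, at angle
  \<open>\<alpha> + pi\<close>.\<close>

lemma psd_mat_1_minus_ket_angle: "psd (mat 1 - ketbra (ket_angle \<alpha>) (ket_angle \<alpha>))"
proof -
  have "mat 1 - ketbra (ket_angle \<alpha>) (ket_angle \<alpha>) = ketbra (ket_angle (\<alpha> + pi)) (ket_angle (\<alpha> + pi))"
  proof -
    have "cis (\<alpha> + pi) = - cis \<alpha>" "cis (- (\<alpha> + pi)) = - cis (- \<alpha>)"
      by (simp_all add: complex_eq_iff)
    then show ?thesis
      by (simp only: vec_eq_iff ketbra_ket_angle_nth vector_minus_component) (simp add: mat_def)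
  qed
  then show ?thesis
    by (simp add: psd_ketbra)
qed

text \<open>Half of the relative phase factors out of \<open>1 + cis (\<beta> - \<alpha>)\<close>
  and leaves twice the cosine of half the difference.\<close>

lemma cinner_ket_angle: "(cmod (cinner (ket_angle \<alpha>) (ket_angle \<beta>)))\<^sup>2 = 1 - (sin ((\<alpha> - \<beta>) / 2))\<^sup>2"
proof -
  have "complex_of_real (sqrt 2) * complex_of_real (sqrt 2) = 2"
    by (simp flip: of_real_mult)
  then have "cinner (ket_angle \<alpha>) (ket_angle \<beta>) = (1 + cis (\<beta> - \<alpha>)) / 2"
    by (simp add: cinner_def ket_angle_nth UNIV_bool cis_cnj cis_mult add_divide_distrib)
  also have "\<dots> = cis ((\<beta> - \<alpha>) / 2) * of_real (cos ((\<alpha> - \<beta>) / 2))"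
  proof -
    have "2 * complex_of_real (cos ((\<alpha> - \<beta>) / 2)) = cis ((\<alpha> - \<beta>) / 2) + cis (- ((\<alpha> - \<beta>) / 2))"
      by (simp add: complex_eq_iff)
    moreover have "cis ((\<beta> - \<alpha>) / 2) * cis ((\<alpha> - \<beta>) / 2) = cis 0"
      unfolding cis_mult by (rule arg_cong[of _ _ cis]) (simp add: field_simps)
    moreover have "cis ((\<beta> - \<alpha>) / 2) * cis (- ((\<alpha> - \<beta>) / 2)) = cis (\<beta> - \<alpha>)"
      unfolding cis_mult by (rule arg_cong[of _ _ cis]) (simp add: field_simps)
    ultimately have "cis ((\<beta> - \<alpha>) / 2) * (2 * of_real (cos ((\<alpha> - \<beta>) / 2))) = 1 + cis (\<beta> - \<alpha>)"
      by (simp only: distrib_left cis_zero)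
    then show ?thesis
      by (simp add: field_simps)
  qed
  finally show ?thesis
    by (simp add: norm_mult cos_squared_eq)
qed

text \<open>
  The difference of the two projections has vanishing diagonal and off-diagonal entry \<open>w\<close> of modulus
  \<open>\<bar>sin ((\<alpha> - \<beta>) / 2)\<bar>\<close>. An equatorial state at angle \<open>arg w + \<pi>\<close> cancels it.
\<close>

lemma psd_ket_angle_diff:
  assumes "\<bar>sin ((\<alpha> - \<beta>) / 2)\<bar> \<le> s"
  shows "psd (s *\<^sub>R mat 1 -
    (ketbra (ket_angle \<alpha>) (ket_angle \<alpha>) - ketbra (ket_angle \<beta>) (ket_angle \<beta>)))"
proof -
  define w where "w = (cis \<alpha> - cis \<beta>) / 2"
  define \<gamma> where "\<gamma> = Arg w + pi"
  have "w = \<i> * of_real (sin ((\<alpha> - \<beta>) / 2)) * cis ((\<alpha> + \<beta>) / 2)"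
  proof -
    have "2 * \<i> * complex_of_real (sin ((\<alpha> - \<beta>) / 2)) = cis ((\<alpha> - \<beta>) / 2) - cis (- ((\<alpha> - \<beta>) / 2))"
      by (simp add: complex_eq_iff)
    moreover have "cis ((\<alpha> - \<beta>) / 2) * cis ((\<alpha> + \<beta>) / 2) = cis \<alpha>"
      unfolding cis_mult by (rule arg_cong[of _ _ cis]) (simp add: field_simps)
    moreover have "cis (- ((\<alpha> - \<beta>) / 2)) * cis ((\<alpha> + \<beta>) / 2) = cis \<beta>"
      unfolding cis_mult by (rule arg_cong[of _ _ cis]) (simp add: field_simps)
    ultimately have "(2 * \<i> * of_real (sin ((\<alpha> - \<beta>) / 2))) * cis ((\<alpha> + \<beta>) / 2) = cis \<alpha> - cis \<beta>"
      by (simp only: left_diff_distrib)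
    then show ?thesis
      by (simp add: w_def field_simps)
  qed
  then have norm_w: "cmod w = \<bar>sin ((\<alpha> - \<beta>) / 2)\<bar>"
    by (simp add: norm_mult)
  have w: "of_real (cmod w) * cis \<gamma> = - w"
    using rcis_cmod_Arg[of w] by (simp add: \<gamma>_def rcis_def flip: minus_cis)
  have "cnj (of_real (cmod w) * cis \<gamma>) = cnj (- w)"
    by (simp only: w)
  then have w': "of_real (cmod w) * cis (- \<gamma>) = - cnj w"
    by (simp add: cis_cnj)
  \<comment> \<open>The equatorial projection has diagonal entries 1/2, so the weight
    \<open>2 * cmod w\<close> puts \<open>cmod w\<close> on the diagonal. The nonnegative rest
    \<open>s - cmod w\<close> goes to the identity.\<close>
  have "s *\<^sub>R mat 1 - (ketbra (ket_angle \<alpha>) (ket_angle \<alpha>) - ketbra (ket_angle \<beta>) (ket_angle \<beta>)) =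
    (s - cmod w) *\<^sub>R mat 1 + (2 * cmod w) *\<^sub>R ketbra (ket_angle \<gamma>) (ket_angle \<gamma>)"
    unfolding vec_eq_iff vector_minus_component vector_add_component vector_scaleR_component
      ketbra_ket_angle_nth
    unfolding scaleR_conv_of_real
    using w w' by (auto simp: mat_def w_def cis_cnj field_simps)
  then show ?thesis
    using assms by (simp add: norm_w psd_add psd_scaleR psd_mat_1 psd_ketbra)
qed

text \<open>Both the rounded and the exact tests are sums of the projections onto such unit vectors,
  one for each assignment \<open>z\<close> on \<open>- A\<close>.\<close>

definition block_vec :: "'v set \<Rightarrow> ('v \<Rightarrow> real) \<Rightarrow> ('v \<Rightarrow> bool) \<Rightarrow> complex ^ ('v::finite \<Rightarrow> bool)" where
  "block_vec A a z = tensor_vec (\<lambda>k. if k \<in> A then ket_angle (a k) else ket (z k))"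

lemma ketbra_block_vec:
  "ketbra (block_vec A a z) (block_vec A a z) =
     tensor_op (\<lambda>k. if k \<in> A then ketbra (ket_angle (a k)) (ket_angle (a k)) else ketbra (ket (z k)) (ket (z k)))"
  unfolding block_vec_def tensor_op_ketbra[symmetric] by (intro arg_cong[of _ _ tensor_op]) auto

lemma local_test_eq:
  "local_test E \<theta> h A =
     (\<Sum>z\<in>(- A) \<rightarrow>\<^sub>E UNIV. ketbra (block_vec A (\<lambda>k. rounded_angle h (local_angle E \<theta> k z)) z)
                              (block_vec A (\<lambda>k. rounded_angle h (local_angle E \<theta> k z)) z))"
  unfolding local_test_def ketbra_block_vec Let_def ..

text \<open>Each identity off \<open>A\<close> is resolved into its two bit projections, and
  distributivity yields one term per bit string on \<open>- A\<close>.\<close>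

lemma tensor_op_sum_blocks:
  "tensor_op (\<lambda>k. if k \<in> A then B k else mat 1) =
     (\<Sum>z\<in>(- A) \<rightarrow>\<^sub>E UNIV. tensor_op (\<lambda>k. if k \<in> A then B k else ketbra (ket (z k)) (ket (z k))))"
proof -
  have split: "(\<Prod>k\<in>UNIV. (if k \<in> A then B k else C k) $ x k $ y k) =
      (\<Prod>k\<in>A. B k $ x k $ y k) * (\<Prod>k\<in>-A. C k $ x k $ y k)" for C x y
    by (subst prod.subset_diff[of A UNIV]) (simp_all add: mult.commute Compl_eq_Diff_UNIV)
  have "(\<Prod>k\<in>-A. (mat 1 :: complex ^ bool ^ bool) $ x k $ y k) =
      (\<Sum>z\<in>(- A) \<rightarrow>\<^sub>E UNIV. \<Prod>k\<in>-A. ketbra (ket (z k)) (ket (z k)) $ x k $ y k)" for x y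
  proof -
    have "(\<Prod>k\<in>-A. (mat 1 :: complex ^ bool ^ bool) $ x k $ y k) =
        (\<Prod>k\<in>-A. \<Sum>b\<in>UNIV. ketbra (ket b) (ket b) $ x k $ y k)"
      by (intro prod.cong refl) (auto simp: ketbra_def ket_nth mat_def UNIV_bool)
    then show ?thesis
      by (simp add: prod_sum_PiE)
  qed
  then show ?thesis
    by (simp add: tensor_op_def vec_eq_iff split sum_distrib_left)
qed

lemma sum_blocks_mat_1:
  "(\<Sum>z\<in>(- A) \<rightarrow>\<^sub>E UNIV. tensor_op (\<lambda>k. if k \<in> A then mat 1 else ketbra (ket (z k)) (ket (z k)))) = mat 1"
  using tensor_op_sum_blocks[of A "\<lambda>_. mat 1"] by (simp add: tensor_op_mat_1)

text \<open>The identity is itself a sum of blocks, so the comparison is made inside each block: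
  \<open>mat 1\<close> against an equatorial projection on \<open>A\<close>, and equality
  elsewhere.\<close>

lemma psd_mat_1_minus_sum_blocks:
  "psd (mat 1 - (\<Sum>z\<in>(- A) \<rightarrow>\<^sub>E UNIV. ketbra (block_vec A (a z) z) (block_vec A (a z) z)))"
  unfolding sum_blocks_mat_1[of A, symmetric] sum_subtractf[symmetric] ketbra_block_vec
  by (intro psd_sum psd_tensor_op_mono)
     (simp_all add: psd_ketbra psd_mat_1_minus_ket_angle psd.zero)

text \<open>In the block of \<open>z\<close>, the majorant in the perturbation bound is the identity
  on \<open>A\<close> and the bit projections of \<open>z\<close> off \<open>A\<close>. These
  majorants sum to \<open>mat 1\<close>, so the constant does not grow with the number of
  blocks.\<close>

lemma psd_sum_blocks_diff:
  assumes "\<And>z k. \<bar>sin ((a z k - b z k) / 2)\<bar> \<le> s"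
  shows "psd ((real (card A) * s) *\<^sub>R mat 1 -
    ((\<Sum>z\<in>(- A) \<rightarrow>\<^sub>E UNIV. ketbra (block_vec A (a z) z) (block_vec A (a z) z)) -
     (\<Sum>z\<in>(- A) \<rightarrow>\<^sub>E UNIV. ketbra (block_vec A (b z) z) (block_vec A (b z) z))))"
proof -
  have "s \<ge> 0"
    using assms abs_ge_zero order_trans by blast
  then show ?thesis
    unfolding sum_blocks_mat_1[of A, symmetric] sum_subtractf[symmetric] ketbra_block_vec scaleR_sum_right
    by (intro psd_sum psd_tensor_op_perturb)
       (simp_all add: psd_ketbra psd_mat_1_minus_ket_angle psd_ket_angle_diff psd.zero assms)
qed

lemma psd_local_test: "psd (local_test E \<theta> h A)"
  unfolding local_test_eq by (intro psd_sum psd_ketbra)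

lemma psd_mat_1_minus_local_test: "psd (mat 1 - local_test E \<theta> h A)"
  unfolding local_test_eq by (rule psd_mat_1_minus_sum_blocks)

lemma psd_test_operator: "psd (test_operator E \<theta> h \<A>)"
  unfolding test_operator_def by (intro psd_scaleR psd_sum psd_local_test) simp

lemma psd_mat_1_minus_test_operator:
  fixes E :: "('v::finite \<times> 'v) set"
  assumes "\<A> \<noteq> {}"
  shows "psd (mat 1 - test_operator E \<theta> h \<A>)"
proof -
  have "card \<A> > 0"
    using assms by (simp add: card_gt_0_iff)
  then have "mat 1 - test_operator E \<theta> h \<A> =
      (1 / real (card \<A>)) *\<^sub>R (\<Sum>A\<in>\<A>. mat 1 - local_test E \<theta> h A)"
    using assms by (simp add: test_operator_def sum_subtractf sum_constant_scaleR
        scaleR_right_diff_distrib del: sum_constant)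
  then show ?thesis
    by (simp add: psd_scaleR psd_sum psd_mat_1_minus_local_test)
qed

text \<open>
  With every factor of the identity expanded as \<open>P + (1 - P)\<close>, a product that contains a factor
  \<open>1 - P\<close> at some site occurs in the term of any \<open>A\<close> that covers this site.
\<close>

lemma psd_cover:
  fixes P :: "'i::finite \<Rightarrow> complex ^ 's ^ 's"
  assumes "\<And>i. psd (P i)" "\<And>i. psd (mat 1 - P i)" and "\<Union>\<A> = UNIV"
  shows "psd ((\<Sum>A\<in>\<A>. mat 1 - tensor_op (\<lambda>i. if i \<in> A then P i else mat 1)) - (mat 1 - tensor_op P))"
proof -
  define T where "T S = tensor_op (\<lambda>i. if i \<in> S then P i else mat 1 - P i)" for S
  have psdT: "psd (T S)" for S
    unfolding T_def by (rule psd_tensor_op) (simp add: assms)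
  have expand: "mat 1 - tensor_op (\<lambda>i. if i \<in> A then P i else mat 1) =
      (\<Sum>S\<in>UNIV. of_bool (\<not> A \<subseteq> S) *\<^sub>R T S)" for A
  proof -
    \<comment> \<open>The summand 0 at the sites of \<open>A\<close> removes all terms in which
      \<open>S\<close> does not contain \<open>A\<close>.\<close>
    have "tensor_op (\<lambda>i. if i \<in> A then P i else mat 1) =
        tensor_op (\<lambda>i. P i + (if i \<in> A then 0 else mat 1 - P i))"
      by (intro arg_cong[of _ _ tensor_op]) auto
    also have "\<dots> = (\<Sum>S\<in>UNIV. of_bool (A \<subseteq> S) *\<^sub>R T S)"
      unfolding tensor_op_expand
    proof (intro sum.cong refl)
      fix S
      show "tensor_op (\<lambda>i. if i \<in> S then P i else if i \<in> A then 0 else mat 1 - P i) =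
        of_bool (A \<subseteq> S) *\<^sub>R T S"
      proof (cases "A \<subseteq> S")
        case True
        then have "(\<lambda>i. if i \<in> S then P i else if i \<in> A then 0 else mat 1 - P i) =
          (\<lambda>i. if i \<in> S then P i else mat 1 - P i)"
          by (intro ext) auto
        with True show ?thesis
          by (simp only: T_def of_bool_eq scaleR_one)
      next
        case False
        then obtain i where "i \<in> A" "i \<notin> S"
          by blast
        then have "tensor_op (\<lambda>i. if i \<in> S then P i else if i \<in> A then 0 else mat 1 - P i) = 0"
          by (intro tensor_op_eq_0[of _ i]) simp
        with False show ?thesis
          by simp
      qed
    qed
    finally have *: "tensor_op (\<lambda>i. if i \<in> A then P i else mat 1) = (\<Sum>S\<in>UNIV. of_bool (A \<subseteq> S) *\<^sub>R T S)" .
    have "mat 1 = (\<Sum>S\<in>UNIV. T S)"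
      using tensor_op_expand[of P "\<lambda>i. mat 1 - P i"] by (simp add: T_def tensor_op_mat_1)
    then have "mat 1 - tensor_op (\<lambda>i. if i \<in> A then P i else mat 1) =
        (\<Sum>S\<in>UNIV. T S - of_bool (A \<subseteq> S) *\<^sub>R T S)"
      by (simp only: * sum_subtractf)
    also have "\<dots> = (\<Sum>S\<in>UNIV. of_bool (\<not> A \<subseteq> S) *\<^sub>R T S)"
      by (intro sum.cong refl) auto
    finally show ?thesis .
  qed
  have "(\<Sum>A\<in>\<A>. mat 1 - tensor_op (\<lambda>i. if i \<in> A then P i else mat 1)) - (mat 1 - tensor_op P) =
      (\<Sum>S\<in>UNIV. (\<Sum>A\<in>\<A>. of_bool (\<not> A \<subseteq> S)) *\<^sub>R T S) - (\<Sum>S\<in>UNIV. of_bool (\<not> UNIV \<subseteq> S) *\<^sub>R T S)"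
  proof -
    have "mat 1 - tensor_op P = (\<Sum>S\<in>UNIV. of_bool (\<not> UNIV \<subseteq> S) *\<^sub>R T S)"
      using expand[of UNIV] by simp
    moreover have "(\<Sum>A\<in>\<A>. mat 1 - tensor_op (\<lambda>i. if i \<in> A then P i else mat 1)) =
        (\<Sum>S\<in>UNIV. (\<Sum>A\<in>\<A>. of_bool (\<not> A \<subseteq> S)) *\<^sub>R T S)"
      unfolding expand scaleR_sum_left by (rule sum.swap)
    ultimately show ?thesis
      by (simp only:)
  qed
  also have "\<dots> = (\<Sum>S\<in>UNIV. ((\<Sum>A\<in>\<A>. of_bool (\<not> A \<subseteq> S)) - of_bool (\<not> UNIV \<subseteq> S)) *\<^sub>R T S)"
    by (simp only: sum_subtractf scaleR_left_diff_distrib)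
  finally have eq: "(\<Sum>A\<in>\<A>. mat 1 - tensor_op (\<lambda>i. if i \<in> A then P i else mat 1)) - (mat 1 - tensor_op P) =
      (\<Sum>S\<in>UNIV. ((\<Sum>A\<in>\<A>. of_bool (\<not> A \<subseteq> S)) - of_bool (\<not> UNIV \<subseteq> S)) *\<^sub>R T S)" .
  have "of_bool (\<not> UNIV \<subseteq> S) \<le> (\<Sum>A\<in>\<A>. of_bool (\<not> A \<subseteq> S) :: real)" for S
  proof (cases "UNIV \<subseteq> S")
    case False
    then obtain A where "A \<in> \<A>" "\<not> A \<subseteq> S"
      using assms(3) by blast
    then show ?thesis
      using member_le_sum[of A \<A> "\<lambda>A. of_bool (\<not> A \<subseteq> S) :: real"] False by simp
  qed (simp add: sum_nonneg)
  then show ?thesis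
    unfolding eq by (intro psd_sum psd_scaleR psdT) simp
qed


section \<open>The weighted graph state\<close>

lemma cis_sum: "cis (\<Sum>a\<in>S. f a) = (\<Prod>a\<in>S. cis (f a))"
  by (induction S rule: infinite_finite_induct) (simp_all flip: cis_mult)

lemma at_site_diagonal_nth: "at_site i A $ x $ x = A $ x i $ x i"
proof -
  have "at_site i A $ x $ x = (\<Prod>j\<in>UNIV. if j = i then A $ x i $ x i else 1)"
    unfolding at_site_def tensor_op_def vec_lambda_beta by (intro prod.cong) (auto simp: mat_def)
  then show ?thesis
    by simp
qed

lemma controlled_phase_nth: "controlled_phase j k t $ x $ x = (if x j \<and> x k then cis t else 1)"
proof -
  have diag: "at_site i (ketbra (ket True) (ket True)) $ x $ y = 0" if "x \<noteq> y" for i x y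
    using that by (intro at_site_diagonal) (auto simp: ketbra_def ket_nth)
  have "(at_site j (ketbra (ket True) (ket True)) ** B) $ x $ x =
      (\<Sum>y\<in>UNIV. if y = x then at_site j (ketbra (ket True) (ket True)) $ x $ x * B $ x $ x else 0)" for B
    unfolding matrix_matrix_mult_def vec_lambda_beta by (intro sum.cong) (auto simp: diag)
  then show ?thesis
    by (simp add: controlled_phase_def at_site_diagonal_nth ketbra_def ket_nth)
qed

text \<open>The exponent in the amplitudes of the graph state: an edge gate acts nontrivially only
  on labels where both of its bits are 1.\<close>

definition edge_phase :: "('v \<times> 'v) set \<Rightarrow> ('v \<Rightarrow> 'v \<Rightarrow> real) \<Rightarrow> ('v \<Rightarrow> bool) \<Rightarrow> real" where
  "edge_phase E \<theta> x = (\<Sum>(j, k)\<in>E. \<theta> j k * of_bool (x j \<and> x k))"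

lemma graph_state_nth:
  fixes E :: "('v::finite \<times> 'v) set"
  shows "graph_state E \<theta> $ x = cis (edge_phase E \<theta> x) * of_real (1 / sqrt 2) ^ CARD('v)"
proof -
  interpret comp_fun_commute "\<lambda>(j, k) \<psi>. controlled_phase j k (\<theta> j k) *v \<psi>"
    by (rule controlled_phase_commute)
  have plus: "ket_plus $ b = of_real (1 / sqrt 2)" for b
    unfolding ket_plus_def vector_scaleR_component by (simp add: ket_nth scaleR_conv_of_real)
  have "finite E"
    by simp
  then show ?thesis
    unfolding graph_state_def edge_phase_def
  proof induction
    case empty
    then show ?case
      by (simp add: tensor_vec_def plus)
  next
    case (insert e E)
    obtain j k where e: "e = (j, k)"
      by fastforce
    have "(controlled_phase j k (\<theta> j k) *v \<psi>) $ x = controlled_phase j k (\<theta> j k) $ x $ x * \<psi> $ x" for \<psi>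
      by (rule diagonal_mult_vec) (rule controlled_phase_diagonal)
    then show ?case
      using insert by (simp add: e controlled_phase_nth flip: cis_mult)
  qed
qed

lemma cinner_graph_state_self: "cinner (graph_state E \<theta>) (graph_state E \<theta>) = 1"
  for E :: "('v::finite \<times> 'v) set"
proof -
  have "cinner (graph_state E \<theta>) (graph_state E \<theta>) =
      (\<Sum>x::'v \<Rightarrow> bool\<in>UNIV. of_real (1 / sqrt 2 * (1 / sqrt 2)) ^ CARD('v))"
    unfolding cinner_def graph_state_nth of_real_mult power_mult_distrib
    by (intro sum.cong refl) (simp add: cis_cnj cis_mult flip: mult.assoc)
  also have "\<dots> = 1"
    by (simp add: card_fun flip: power_mult_distrib)
  finally show ?thesis .
qed

text \<open>No edge has both ends in \<open>A\<close>, so each edge either avoids \<open>A\<close>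
  or meets it in exactly one end. The edges of the second kind, grouped by that end, make up the
  local angles.\<close>

lemma edge_phase_split:
  assumes "weighted_graph E \<theta>" and "independent_set E A"
  shows "edge_phase E \<theta> x =
    edge_phase (E \<inter> (- A) \<times> (- A)) \<theta> x + (\<Sum>k\<in>A. local_angle E \<theta> k x * of_bool (x k))"
proof -
  define g where "g j k = \<theta> j k * of_bool (x j \<and> x k)" for j k
  have sym: "g j k = g k j" for j k
    using assms(1) by (simp add: g_def weighted_graph_def conj_commute)
  \<comment> \<open>Indicators turn sums over edges into sums over all pairs, where the two ends can
    be summed in either order.\<close>
  have edge_sum: "(\<Sum>(j, k)\<in>E. f j k) = (\<Sum>j\<in>UNIV. \<Sum>k\<in>UNIV. of_bool ((j, k) \<in> E) * f j k)"
    for f :: "'a \<Rightarrow> 'a \<Rightarrow> real"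
  proof -
    have "(\<Sum>(j, k)\<in>E. f j k) = (\<Sum>p\<in>UNIV. of_bool (p \<in> E) * (case p of (j, k) \<Rightarrow> f j k))"
      by (intro sum.mono_neutral_cong_left) auto
    then show ?thesis
      unfolding sum.cartesian_product by (simp add: case_prod_unfold)
  qed
  have local: "local_angle E \<theta> k x * of_bool (x k) =
      (\<Sum>j\<in>UNIV. of_bool ((j, k) \<in> E) * g j k) + (\<Sum>j\<in>UNIV. of_bool ((k, j) \<in> E) * g k j)" for k
  proof -
    \<comment> \<open>Edges are stored in increasing order only, so a neighbour is counted
      once.\<close>
    have "j < k" if "(j, k) \<in> E" for j k
      using assms(1) that by (auto simp: weighted_graph_def)
    then have "\<not> ((j, k) \<in> E \<and> (k, j) \<in> E)" for j
      using less_asym by blast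
    then have "of_bool (j \<in> neighbours E k) * g j k =
        of_bool ((j, k) \<in> E) * g j k + of_bool ((k, j) \<in> E) * g k j" for j
      by (auto simp: neighbours_def sym[of k j])
    moreover have "local_angle E \<theta> k x * of_bool (x k) = (\<Sum>j\<in>UNIV. of_bool (j \<in> neighbours E k) * g j k)"
      unfolding local_angle_def sum_distrib_right
      by (intro sum.mono_neutral_cong_left) (auto simp: g_def)
    ultimately show ?thesis
      by (simp add: sum.distrib)
  qed
  have restrict: "(\<Sum>k\<in>A. f k) = (\<Sum>k\<in>UNIV. of_bool (k \<in> A) * f k)" for f :: "'a \<Rightarrow> real"
    by (intro sum.mono_neutral_cong_left) auto
  have right: "(\<Sum>k\<in>A. \<Sum>j\<in>UNIV. of_bool ((j, k) \<in> E) * g j k) = (\<Sum>(j, k)\<in>E. of_bool (k \<in> A) * g j k)"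
    unfolding edge_sum restrict sum_distrib_left
    by (subst sum.swap) (simp add: mult_ac)
  have left: "(\<Sum>k\<in>A. \<Sum>j\<in>UNIV. of_bool ((k, j) \<in> E) * g k j) = (\<Sum>(j, k)\<in>E. of_bool (j \<in> A) * g j k)"
    unfolding edge_sum restrict sum_distrib_left
    by (simp add: mult_ac)
  have rest: "edge_phase (E \<inter> (- A) \<times> (- A)) \<theta> x = (\<Sum>(j, k)\<in>E. of_bool (j \<notin> A \<and> k \<notin> A) * g j k)"
    unfolding edge_phase_def by (intro sum.mono_neutral_cong_left) (auto simp: g_def)
  have "of_bool (j \<notin> A \<and> k \<notin> A) + (of_bool (k \<in> A) + of_bool (j \<in> A)) = (1 :: real)" if "(j, k) \<in> E" for j k
    using assms(2) that by (auto simp: independent_set_def neighbours_def)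
  then have "g j k = of_bool (j \<notin> A \<and> k \<notin> A) * g j k + (of_bool (k \<in> A) * g j k + of_bool (j \<in> A) * g j k)"
    if "(j, k) \<in> E" for j k
    using that by (metis distrib_right mult_1)
  then have "edge_phase E \<theta> x = (\<Sum>(j, k)\<in>E. of_bool (j \<notin> A \<and> k \<notin> A) * g j k +
      (of_bool (k \<in> A) * g j k + of_bool (j \<in> A) * g j k))"
    unfolding edge_phase_def by (intro sum.cong) (auto simp: g_def)
  also have "\<dots> = (\<Sum>(j, k)\<in>E. of_bool (j \<notin> A \<and> k \<notin> A) * g j k) +
      ((\<Sum>(j, k)\<in>E. of_bool (k \<in> A) * g j k) + (\<Sum>(j, k)\<in>E. of_bool (j \<in> A) * g j k))"
    by (simp only: case_prod_unfold sum.distrib)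
  finally show ?thesis
    by (simp only: rest local sum.distrib left right)
qed

text \<open>The first term reads only bits off \<open>A\<close>, and by independence so do the local
  angles at sites of \<open>A\<close>. For fixed \<open>z\<close> the phase is therefore affine in
  the bits on \<open>A\<close>, as for a product of equatorial states.\<close>

lemma edge_phase_block:
  assumes "weighted_graph E \<theta>" and "independent_set E A" and "\<forall>k\<in>-A. x k = z k"
  shows "edge_phase E \<theta> x =
    edge_phase (E \<inter> (- A) \<times> (- A)) \<theta> z + (\<Sum>k\<in>A. local_angle E \<theta> k z * of_bool (x k))"
proof -
  have "edge_phase (E \<inter> (- A) \<times> (- A)) \<theta> x = edge_phase (E \<inter> (- A) \<times> (- A)) \<theta> z"
    unfolding edge_phase_def using assms(3) by (intro sum.cong) auto
  moreover have "local_angle E \<theta> k x = local_angle E \<theta> k z" if "k \<in> A" for k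
  proof -
    have "neighbours E k \<subseteq> -A"
      using assms(2) that by (auto simp: independent_set_def)
    then show ?thesis
      unfolding local_angle_def using assms(3) by (intro sum.cong) auto
  qed
  ultimately show ?thesis
    using edge_phase_split[OF assms(1,2), of x] by simp
qed

lemma block_vec_nth:
  "block_vec A a z $ x = (if \<forall>k\<in>-A. x k = z k
     then of_real (1 / sqrt 2) ^ card A * cis (\<Sum>k\<in>A. a k * of_bool (x k)) else 0)"
proof -
  have "block_vec A a z $ x = (\<Prod>k\<in>A. ket_angle (a k) $ x k) * (\<Prod>k\<in>-A. of_bool (x k = z k))"
    unfolding block_vec_def tensor_vec_def vec_lambda_beta Compl_eq_Diff_UNIV
    by (subst prod.subset_diff[of A UNIV]) (simp_all add: ket_nth mult.commute)
  moreover have "(\<Prod>k\<in>-A. of_bool (x k = z k)) = (of_bool (\<forall>k\<in>-A. x k = z k) :: complex)"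
    by auto
  moreover have "(\<Prod>k\<in>A. ket_angle (a k) $ x k) =
      of_real (1 / sqrt 2) ^ card A * cis (\<Sum>k\<in>A. a k * of_bool (x k))"
    unfolding ket_angle_nth prod.distrib cis_sum by (auto intro!: prod.cong)
  ultimately show ?thesis
    by simp
qed

text \<open>On the block of \<open>z\<close> the edge phases rotate the plus states to the local
  angles; off the block both sides vanish. The extra factor depends on \<open>z\<close> alone and
  cancels in projections.\<close>

lemma phase_block_vec:
  assumes "weighted_graph E \<theta>" and "independent_set E A"
  shows "cis (edge_phase E \<theta> x) * block_vec A (\<lambda>_. 0) z $ x =
    cis (edge_phase (E \<inter> (- A) \<times> (- A)) \<theta> z) * block_vec A (\<lambda>k. local_angle E \<theta> k z) z $ x"
  using edge_phase_block[OF assms, of x z] by (simp add: block_vec_nth mult_ac flip: cis_mult)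

text \<open>Within the block of \<open>z\<close> the graph state is a multiple of the exact block
  vector, and outside of it \<open>block_vec A b z\<close> vanishes.\<close>

lemma cinner_block_vec_graph_state:
  fixes E :: "('v::{finite,linorder} \<times> 'v) set"
  assumes "weighted_graph E \<theta>" and "independent_set E A"
  shows "cinner (block_vec A b z) (graph_state E \<theta>) =
    of_real (1 / sqrt 2) ^ card (- A) * cis (edge_phase (E \<inter> (- A) \<times> (- A)) \<theta> z) *
    cinner (block_vec A b z) (block_vec A (\<lambda>k. local_angle E \<theta> k z) z)"
proof -
  have card: "CARD('v) = card (- A) + card A"
    using card_Un_disjoint[of "- A" A] by simp
  have "graph_state E \<theta> $ x = of_real (1 / sqrt 2) ^ card (- A) *
      cis (edge_phase (E \<inter> (- A) \<times> (- A)) \<theta> z) * block_vec A (\<lambda>k. local_angle E \<theta> k z) z $ x"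
    if "\<forall>k\<in>-A. x k = z k" for x
    using that edge_phase_block[OF assms that]
    unfolding graph_state_nth block_vec_nth card power_add by (simp add: mult_ac flip: cis_mult)
  then have "cnj (block_vec A b z $ x) * graph_state E \<theta> $ x = of_real (1 / sqrt 2) ^ card (- A) *
      cis (edge_phase (E \<inter> (- A) \<times> (- A)) \<theta> z) *
      (cnj (block_vec A b z $ x) * block_vec A (\<lambda>k. local_angle E \<theta> k z) z $ x)" for x
    by (cases "\<forall>k\<in>-A. x k = z k") (auto simp: block_vec_nth[of A b])
  then show ?thesis
    by (simp only: cinner_def sum_distrib_left)
qed

lemma cinner_block_vec:
  "cinner (block_vec A a z) (block_vec A b z) = (\<Prod>k\<in>A. cinner (ket_angle (a k)) (ket_angle (b k)))"
proof -
  have "cinner (ket c) (ket c) = 1" for c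
    by (cases c) (simp_all add: cinner_def ket_nth UNIV_bool)
  then have "cinner (block_vec A a z) (block_vec A b z) =
      (\<Prod>k\<in>UNIV. if k \<in> A then cinner (ket_angle (a k)) (ket_angle (b k)) else 1)"
    unfolding block_vec_def cinner_tensor_vec by (intro prod.cong) auto
  then show ?thesis
    by (simp flip: prod.inter_restrict)
qed


section \<open>Completeness and soundness of the test\<close>

text \<open>Rounding moves an angle by at most \<open>pi / (2 * h)\<close>. Half of this is at most
  \<open>pi / 2\<close>, up to which the sine is monotone.\<close>

lemma rounded_angle_error:
  assumes "h \<ge> 1"
  shows "\<bar>sin ((rounded_angle h \<alpha> - \<alpha>) / 2)\<bar> \<le> sin (pi / (4 * real h))"
proof -
  have "\<bar>rounded_angle h \<alpha> - \<alpha>\<bar> \<le> pi / (2 * real h)"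
    using theI'[OF rounded_angle_unique[OF assms, of \<alpha>]]
    unfolding rounded_angle_def of_nat_mult of_nat_numeral by linarith
  then have le: "\<bar>(rounded_angle h \<alpha> - \<alpha>) / 2\<bar> \<le> pi / (4 * real h)"
    by simp
  have "pi / (4 * real h) \<le> pi / 2"
    using assms by (simp add: field_simps)
  with le have "sin \<bar>(rounded_angle h \<alpha> - \<alpha>) / 2\<bar> \<ge> 0"
    using pi_gt_zero by (intro sin_ge_zero) linarith+
  then have "\<bar>sin ((rounded_angle h \<alpha> - \<alpha>) / 2)\<bar> = sin \<bar>(rounded_angle h \<alpha> - \<alpha>) / 2\<bar>"
    by (cases "(rounded_angle h \<alpha> - \<alpha>) / 2 \<ge> 0") (simp_all add: minus_divide_left[symmetric] del: minus_diff_eq)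
  then show ?thesis
    using le \<open>pi / (4 * real h) \<le> pi / 2\<close> by (simp add: sin_mono_le_eq)
qed

lemma cinner_sum_ketbra:
  "cinner v ((\<Sum>a\<in>S. ketbra (w a) (w a)) *v v) = of_real (\<Sum>a\<in>S. (cmod (cinner (w a) v))\<^sup>2)"
proof -
  have "cinner v (ketbra u u *v v) = of_real ((cmod (cinner u v))\<^sup>2)" for u
  proof -
    have "ketbra u u *v v = cinner u v *s u"
      by (simp add: ketbra_def cinner_def matrix_vector_mult_def vec_eq_iff
          sum_distrib_left sum_distrib_right mult_ac)
    moreover have "cnj (cinner u v) = cinner v u"
      by (simp add: cinner_def mult.commute)
    moreover have "cinner v (c *s u) = c * cinner v u" for c
      by (simp add: cinner_def sum_distrib_left mult_ac)
    ultimately have "cinner v (ketbra u u *v v) = cinner u v * cnj (cinner u v)"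
      by simp
    then show ?thesis
      by (simp only: complex_norm_square)
  qed
  moreover have "trace ((\<Sum>a\<in>S. ketbra (w a) (w a)) ** ketbra v v) =
      (\<Sum>a\<in>S. trace (ketbra (w a) (w a) ** ketbra v v))"
    by (simp only: trace_mul_sym[of _ "ketbra v v"] matrix_mult_sum_right trace_sum)
  ultimately show ?thesis
    by (simp add: cinner_eq_trace)
qed

text \<open>Each block has weight \<open>2 ^ (- card (- A))\<close> in the graph state and there are
  \<open>2 ^ card (- A)\<close> blocks, so the powers of 2 cancel. What is left is one squared
  cosine per site of \<open>A\<close>.\<close>

lemma local_test_expectation:
  fixes E :: "('v::{finite,linorder} \<times> 'v) set"
  assumes "weighted_graph E \<theta>" and "independent_set E A" and "h \<ge> 1"
  obtains r where "cinner (graph_state E \<theta>) (local_test E \<theta> h A *v graph_state E \<theta>) = of_real r"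
    and "r \<ge> (1 - (sin (pi / (4 * real h)))\<^sup>2) ^ card A"
proof -
  define s where "s = sin (pi / (4 * real h))"
  define w where "w z = block_vec A (\<lambda>k. rounded_angle h (local_angle E \<theta> k z)) z" for z
  have overlap: "(cmod (cinner (w z) (graph_state E \<theta>)))\<^sup>2 \<ge> (1 / 2) ^ card (- A) * (1 - s\<^sup>2) ^ card A" for z
  proof -
    have "(1 - s\<^sup>2) ^ card A \<le>
        (\<Prod>k\<in>A. (cmod (cinner (ket_angle (rounded_angle h (local_angle E \<theta> k z))) (ket_angle (local_angle E \<theta> k z))))\<^sup>2)"
      unfolding cinner_ket_angle prod_constant[symmetric]
    proof (intro prod_mono conjI)
      fix k
      show "1 - s\<^sup>2 \<le> 1 - (sin ((rounded_angle h (local_angle E \<theta> k z) - local_angle E \<theta> k z) / 2))\<^sup>2"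
        using rounded_angle_error[OF assms(3), of "local_angle E \<theta> k z"]
        by (simp add: s_def abs_le_square_iff[symmetric])
    qed (simp add: s_def abs_square_le_1)
    also have "\<dots> = (cmod (cinner (w z) (block_vec A (\<lambda>k. local_angle E \<theta> k z) z)))\<^sup>2"
      by (simp add: w_def cinner_block_vec prod_norm[symmetric] prod_power_distrib)
    finally have "(1 / 2) ^ card (- A) * (1 - s\<^sup>2) ^ card A \<le>
        (1 / 2) ^ card (- A) * (cmod (cinner (w z) (block_vec A (\<lambda>k. local_angle E \<theta> k z) z)))\<^sup>2"
      by (intro mult_left_mono) simp_all
    also have "\<dots> = (cmod (cinner (w z) (graph_state E \<theta>)))\<^sup>2"
      unfolding w_def cinner_block_vec_graph_state[OF assms(1,2)]
      by (simp add: norm_mult norm_power norm_divide power_mult_distrib power_divide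
          flip: power_mult) (simp add: power_mult mult.commute[of _ 2])
    finally show ?thesis .
  qed
  have "(1 - s\<^sup>2) ^ card A =
      (\<Sum>z\<in>(- A) \<rightarrow>\<^sub>E (UNIV :: bool set). (1 / 2) ^ card (- A) * (1 - s\<^sup>2) ^ card A)"
    by (simp add: card_PiE flip: power_mult_distrib)
  also have "\<dots> \<le> (\<Sum>z\<in>(- A) \<rightarrow>\<^sub>E UNIV. (cmod (cinner (w z) (graph_state E \<theta>)))\<^sup>2)"
    by (intro sum_mono overlap)
  finally have "(1 - s\<^sup>2) ^ card A \<le> (\<Sum>z\<in>(- A) \<rightarrow>\<^sub>E UNIV. (cmod (cinner (w z) (graph_state E \<theta>)))\<^sup>2)" .
  moreover have "cinner (graph_state E \<theta>) (local_test E \<theta> h A *v graph_state E \<theta>) =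
      of_real (\<Sum>z\<in>(- A) \<rightarrow>\<^sub>E UNIV. (cmod (cinner (w z) (graph_state E \<theta>)))\<^sup>2)"
    unfolding local_test_eq w_def by (rule cinner_sum_ketbra)
  ultimately show ?thesis
    using that unfolding s_def by blast
qed

text \<open>All choices of the omitted copy give the same value, with factor 1 at that copy and
  \<open>r\<close> at the other \<open>N\<close>.\<close>

lemma passing_probability_tensor_power:
  fixes v :: "complex ^ 's"
  assumes "cinner v v = 1" and "cinner v (\<Omega> *v v) = of_real r" and "CARD('c::finite) = N + 1"
  shows "passing_probability \<Omega> (ketbra (tensor_vec (\<lambda>_::'c. v)) (tensor_vec (\<lambda>_. v))) = r ^ N"
proof -
  have "trace (omit_copy \<Omega> i ** ketbra (tensor_vec (\<lambda>_. v)) (tensor_vec (\<lambda>_. v))) = of_real (r ^ N)" for i :: 'c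
  proof -
    have "trace (omit_copy \<Omega> i ** ketbra (tensor_vec (\<lambda>_. v)) (tensor_vec (\<lambda>_. v))) =
        (\<Prod>j\<in>UNIV. cinner v ((if j = i then mat 1 else \<Omega>) *v v))"
      by (simp only: cinner_eq_trace omit_copy_def tensor_op_mult_vec cinner_tensor_vec)
    also have "\<dots> = (\<Prod>j\<in>UNIV. if j = i then 1 else of_real r)"
      by (intro prod.cong) (simp_all add: assms)
    also have "\<dots> = (\<Prod>j\<in>UNIV - {i}. of_real r)"
      by (subst prod.remove[of _ i]) (auto intro: prod.cong)
    finally show ?thesis
      by (simp add: assms(3) card_Diff_singleton)
  qed
  then show ?thesis
    by (simp add: passing_probability_def)
qed

text \<open>As the base lies between 0 and 1, the largest set of the cover gives a lower bound
  common to all terms of the average.\<close>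

lemma test_operator_expectation:
  fixes E :: "('v::{finite,linorder} \<times> 'v) set"
  assumes "weighted_graph E \<theta>" and "independence_cover E \<A>" and "h \<ge> 1"
  obtains r where "cinner (graph_state E \<theta>) (test_operator E \<theta> h \<A> *v graph_state E \<theta>) = of_real r"
    and "r \<ge> (1 - (sin (pi / (4 * real h)))\<^sup>2) ^ Max (card ` \<A>)"
proof -
  define G where "G = graph_state E \<theta>"
  define c where "c = 1 - (sin (pi / (4 * real h)))\<^sup>2"
  have c: "0 \<le> c" "c \<le> 1"
    by (simp_all add: c_def abs_square_le_1)
  have "\<exists>r. cinner G (local_test E \<theta> h A *v G) = of_real r \<and> r \<ge> c ^ card A" if "A \<in> \<A>" for A
  proof -
    have "independent_set E A"
      using assms(2) that by (simp add: independence_cover_def)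
    from local_test_expectation[OF assms(1) this assms(3)] show ?thesis
      unfolding G_def c_def by blast
  qed
  then obtain r where r: "\<And>A. A \<in> \<A> \<Longrightarrow> cinner G (local_test E \<theta> h A *v G) = of_real (r A)"
    "\<And>A. A \<in> \<A> \<Longrightarrow> r A \<ge> c ^ card A"
    by metis
  have "\<A> \<noteq> {}"
    using assms(2) by (auto simp: independence_cover_def partition_on_def)
  then have m: "card \<A> > 0"
    by (simp add: card_gt_0_iff)
  have "cinner G (test_operator E \<theta> h \<A> *v G) = trace (ketbra G G ** test_operator E \<theta> h \<A>)"
    unfolding cinner_eq_trace[symmetric] by (rule trace_mul_sym)
  also have "ketbra G G ** test_operator E \<theta> h \<A> =
      (1 / real (card \<A>)) *\<^sub>R (\<Sum>A\<in>\<A>. ketbra G G ** local_test E \<theta> h A)"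
    unfolding test_operator_def by (simp only: matrix_mult_scaleR_right matrix_mult_sum_right)
  also have "trace \<dots> = (1 / real (card \<A>)) *\<^sub>R (\<Sum>A\<in>\<A>. of_real (r A))"
    unfolding trace_scaleR trace_sum
    by (intro arg_cong[of _ _ "scaleR _"] sum.cong refl)
       (simp only: trace_mul_sym[of "ketbra G G"] cinner_eq_trace r)
  also have "\<dots> = of_real ((\<Sum>A\<in>\<A>. r A) / real (card \<A>))"
    by (simp add: scaleR_conv_of_real)
  finally have eq: "cinner G (test_operator E \<theta> h \<A> *v G) = of_real ((\<Sum>A\<in>\<A>. r A) / real (card \<A>))" .
  have "c ^ Max (card ` \<A>) \<le> r A" if "A \<in> \<A>" for A
  proof -
    have "c ^ Max (card ` \<A>) \<le> c ^ card A"
      using c that by (intro power_decreasing Max_ge) auto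
    then show ?thesis
      using r(2)[OF that] by linarith
  qed
  then have "real (card \<A>) * c ^ Max (card ` \<A>) \<le> (\<Sum>A\<in>\<A>. r A)"
    using sum_bounded_below[of \<A> "c ^ Max (card ` \<A>)" r] by simp
  then have "c ^ Max (card ` \<A>) \<le> (\<Sum>A\<in>\<A>. r A) / real (card \<A>)"
    using m by (simp add: field_simps)
  then show ?thesis
    using eq that unfolding G_def c_def by blast
qed

section \<open>Tests with exact angles\<close>

definition exact_test ::
  "('v \<times> 'v) set \<Rightarrow> ('v \<Rightarrow> 'v \<Rightarrow> real) \<Rightarrow> 'v set \<Rightarrow> complex ^ ('v::finite \<Rightarrow> bool) ^ ('v \<Rightarrow> bool)" where
  "exact_test E \<theta> A = (\<Sum>z\<in>(- A) \<rightarrow>\<^sub>E UNIV.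
     ketbra (block_vec A (\<lambda>k. local_angle E \<theta> k z) z) (block_vec A (\<lambda>k. local_angle E \<theta> k z) z))"

lemma psd_exact_test_diff:
  assumes "h \<ge> 1"
  shows "psd ((real (card A) * sin (pi / (4 * real h))) *\<^sub>R mat 1 -
    (local_test E \<theta> h A - exact_test E \<theta> A))"
  unfolding local_test_eq exact_test_def by (intro psd_sum_blocks_diff rounded_angle_error assms)

text \<open>
  Conjugation by the diagonal of all edge phases turns the exact tests into projections onto
  \<open>|+\<rangle>\<close> at the sites of \<open>A\<close>.
\<close>

lemma psd_exact_test_cover:
  fixes E :: "('v::{finite,linorder} \<times> 'v) set"
  assumes "weighted_graph E \<theta>" and "independence_cover E \<A>"
  shows "psd ((\<Sum>A\<in>\<A>. mat 1 - exact_test E \<theta> A) -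
    (mat 1 - ketbra (graph_state E \<theta>) (graph_state E \<theta>)))"
proof -
  define u where "u x = cis (edge_phase E \<theta> x)" for x
  define P where "P = ketbra (ket_angle 0) (ket_angle 0)"
  define Q where "Q A = tensor_op (\<lambda>k::'v. if k \<in> A then P else mat 1)" for A
  have exact: "u x * Q A $ x $ y * cnj (u y) = exact_test E \<theta> A $ x $ y" if "A \<in> \<A>" for A x y
  proof -
    have indep: "independent_set E A"
      using assms(2) that by (simp add: independence_cover_def)
    have "Q A = (\<Sum>z\<in>(- A) \<rightarrow>\<^sub>E UNIV. ketbra (block_vec A (\<lambda>_. 0) z) (block_vec A (\<lambda>_. 0) z))"
      unfolding Q_def P_def tensor_op_sum_blocks ketbra_block_vec ..
    moreover have "u x * ketbra (block_vec A (\<lambda>_. 0) z) (block_vec A (\<lambda>_. 0) z) $ x $ y * cnj (u y) =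
        ketbra (block_vec A (\<lambda>k. local_angle E \<theta> k z) z) (block_vec A (\<lambda>k. local_angle E \<theta> k z) z) $ x $ y" for z
    proof -
      have "u x * ketbra (block_vec A (\<lambda>_. 0) z) (block_vec A (\<lambda>_. 0) z) $ x $ y * cnj (u y) =
          (u x * block_vec A (\<lambda>_. 0) z $ x) * cnj (u y * block_vec A (\<lambda>_. 0) z $ y)"
        by (simp add: ketbra_def mult_ac)
      also have "\<dots> = ketbra (block_vec A (\<lambda>k. local_angle E \<theta> k z) z) (block_vec A (\<lambda>k. local_angle E \<theta> k z) z) $ x $ y *
          (cis (edge_phase (E \<inter> (- A) \<times> (- A)) \<theta> z) * cnj (cis (edge_phase (E \<inter> (- A) \<times> (- A)) \<theta> z)))"
        unfolding u_def phase_block_vec[OF assms(1) indep] by (simp add: ketbra_def mult_ac)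
      finally show ?thesis
        by (simp add: cis_cnj cis_mult)
    qed
    ultimately show ?thesis
      by (simp add: exact_test_def sum_distrib_left sum_distrib_right)
  qed
  \<comment> \<open>\<open>P\<close> on every site is the projection onto the uniform product state,
    which the edge phases turn into the graph state.\<close>
  have state: "u x * tensor_op (\<lambda>_. P) $ x $ y * cnj (u y) = ketbra (graph_state E \<theta>) (graph_state E \<theta>) $ x $ y" for x y
  proof -
    have "ket_angle 0 $ b = of_real (1 / sqrt 2)" for b
      by (simp add: ket_angle_nth)
    then show ?thesis
      unfolding P_def tensor_op_ketbra
      by (simp add: ketbra_def tensor_vec_def graph_state_nth u_def)
  qed
  have one: "u x * mat 1 $ x $ y * cnj (u y) = mat 1 $ x $ y" for x y
    by (simp add: mat_def u_def cis_cnj cis_mult)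
  have "psd ((\<Sum>A\<in>\<A>. mat 1 - Q A) - (mat 1 - tensor_op (\<lambda>_. P)))"
    unfolding Q_def P_def using assms(2)
    by (intro psd_cover psd_ketbra psd_mat_1_minus_ket_angle)
       (simp add: independence_cover_def partition_on_def)
  then have "psd (\<chi> x y. u x * ((\<Sum>A\<in>\<A>. mat 1 - Q A) - (mat 1 - tensor_op (\<lambda>_. P))) $ x $ y * cnj (u y))"
    by (rule psd_diagonal_conjugate)
  also have "(\<chi> x y. u x * ((\<Sum>A\<in>\<A>. mat 1 - Q A) - (mat 1 - tensor_op (\<lambda>_. P))) $ x $ y * cnj (u y)) =
      (\<Sum>A\<in>\<A>. mat 1 - exact_test E \<theta> A) - (mat 1 - ketbra (graph_state E \<theta>) (graph_state E \<theta>))"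
    by (simp add: vec_eq_iff left_diff_distrib right_diff_distrib sum_distrib_left sum_distrib_right
        state one exact)
  finally show ?thesis .
qed


theorem theorem2:
  fixes E :: "('v::{finite,linorder} \<times> 'v) set"
    and \<theta> :: "'v \<Rightarrow> 'v \<Rightarrow> real"
    and \<A> :: "'v set set"
    and n m h N :: nat
    and \<beta> :: real
  assumes "weighted_graph E \<theta>"
    and "CARD('v) = n"
    and "independence_cover E \<A>"
    and "card \<A> = m"
    and "h \<ge> 1"
    and "N \<ge> 1"
    and "CARD('c::finite) = N + 1"
    and "0 < \<beta>" and "\<beta> \<le> 1" and "\<beta> \<ge> 1 / (real N + 1)"
  shows "(let \<Psi> = tensor_vec (\<lambda>_::'c. graph_state E \<theta>) in
           passing_probability (test_operator E \<theta> h \<A>) (ketbra \<Psi> \<Psi>)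
             \<ge> (1 - (sin (pi / (4 * real h)))\<^sup>2) ^ (N * Max (card ` \<A>)))
       \<and> (\<forall>\<rho> :: complex ^ ('c \<Rightarrow> 'v \<Rightarrow> bool) ^ ('c \<Rightarrow> 'v \<Rightarrow> bool).
            density_operator \<rho> \<longrightarrow>
            passing_probability (test_operator E \<theta> h \<A>) \<rho> \<ge> \<beta> \<longrightarrow>
            Re (cinner (graph_state E \<theta>)
                  (resultant_state (test_operator E \<theta> h \<A>) \<rho> *v graph_state E \<theta>))
              \<ge> 1 - (real m * (1 - \<beta>) / (\<beta> * real N) + real n * sin (pi / (4 * real h))))"
proof -
  define s where "s = sin (pi / (4 * real h))"
  define G where "G = graph_state E \<theta>"
  define \<Omega> where "\<Omega> = test_operator E \<theta> h \<A>"
  define c where "c = (1 - s\<^sup>2) ^ Max (card ` \<A>)"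
  have partition: "partition_on UNIV \<A>"
    using assms(3) by (simp add: independence_cover_def)
  have "\<A> \<noteq> {}"
    using partition by (auto simp: partition_on_def)
  then have m: "m > 0"
    using assms(4) by (auto simp: card_gt_0_iff)
  \<comment> \<open>Disjointness of the cover makes the rounding errors \<open>card A * s\<close>
    add up to \<open>n * s\<close>.\<close>
  have card_sum: "(\<Sum>A\<in>\<A>. card A) = n"
    using partition assms(2) product_partition[of UNIV \<A>] by simp
  have psd_\<Omega>: "psd \<Omega>" "psd (mat 1 - \<Omega>)"
    using \<open>\<A> \<noteq> {}\<close> by (simp_all add: \<Omega>_def psd_test_operator psd_mat_1_minus_test_operator)

  have completeness: "passing_probability \<Omega> (ketbra (tensor_vec (\<lambda>_::'c. G)) (tensor_vec (\<lambda>_. G)))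
      \<ge> (1 - s\<^sup>2) ^ (N * Max (card ` \<A>))"
  proof -
    obtain r where r: "cinner G (\<Omega> *v G) = of_real r" "r \<ge> c"
      using test_operator_expectation[OF assms(1,3,5)] unfolding G_def \<Omega>_def c_def s_def by blast
    have "c \<ge> 0"
      by (simp add: c_def s_def abs_square_le_1)
    then have "c ^ N \<le> r ^ N"
      using r(2) by (intro power_mono)
    moreover have "(1 - s\<^sup>2) ^ (N * Max (card ` \<A>)) = c ^ N"
      by (simp add: c_def mult.commute flip: power_mult)
    moreover have "passing_probability \<Omega> (ketbra (tensor_vec (\<lambda>_::'c. G)) (tensor_vec (\<lambda>_. G))) = r ^ N"
      using r(1) assms(7) unfolding G_def
      by (intro passing_probability_tensor_power cinner_graph_state_self)
    ultimately show ?thesis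
      by simp
  qed

  have soundness: "Re (cinner G (resultant_state \<Omega> \<rho> *v G)) \<ge>
      1 - (real m * (1 - \<beta>) / (\<beta> * real N) + real n * s)"
    if \<rho>: "density_operator \<rho>" "passing_probability \<Omega> \<rho> \<ge> \<beta>"
    for \<rho> :: "complex ^ ('c \<Rightarrow> 'v \<Rightarrow> bool) ^ ('c \<Rightarrow> 'v \<Rightarrow> bool)"
  proof -
    \<comment> \<open>Apart from the bound for \<open>\<Omega>\<close>, the resultant state enters
      only through this functional, which is linear, nonnegative on \<open>psd\<close> and
      normalised.\<close>
    define f where "f X = Re (trace (resultant_state \<Omega> \<rho> ** X))" for X
    have pos: "passing_probability \<Omega> \<rho> > 0"
      using \<rho>(2) assms(8) by linarith
    have f_psd: "f X \<ge> 0" if "psd X" for X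
      unfolding f_def using \<rho>(1) psd_\<Omega>(1) that pos by (rule Re_trace_resultant_state_psd)
    have f_1: "f (mat 1) = 1"
      unfolding f_def using pos by (rule Re_trace_resultant_state_mat_1)
    note f_linear = f_def Re_trace_mult_diff Re_trace_mult_scaleR Re_trace_mult_sum
    have "1 - (1 - \<beta>) / (\<beta> * real N) \<le> f \<Omega>"
      unfolding f_def using \<rho>(1) psd_\<Omega> assms(7,6) \<rho>(2) assms(8)
      by (rule Re_trace_resultant_state_test)
    also have "f \<Omega> = (\<Sum>A\<in>\<A>. f (local_test E \<theta> h A)) / real m"
      unfolding \<Omega>_def test_operator_def f_linear by (simp add: assms(4))
    \<comment> \<open>Undoing the average over the cover multiplies the sampling error by
      \<open>m\<close>.\<close>
    finally have tests: "real m * (1 - (1 - \<beta>) / (\<beta> * real N)) \<le> (\<Sum>A\<in>\<A>. f (local_test E \<theta> h A))"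
      using m by (simp add: pos_le_divide_eq mult.commute)
    have "f (local_test E \<theta> h A) \<le> f (exact_test E \<theta> A) + real (card A) * s" for A
      using f_psd[OF psd_exact_test_diff[OF assms(5), of A E \<theta>]] f_1 unfolding f_linear s_def by simp
    then have "(\<Sum>A\<in>\<A>. f (local_test E \<theta> h A)) \<le> (\<Sum>A\<in>\<A>. f (exact_test E \<theta> A) + real (card A) * s)"
      by (rule sum_mono)
    also have "\<dots> = (\<Sum>A\<in>\<A>. f (exact_test E \<theta> A)) + real n * s"
      by (simp add: sum.distrib card_sum[symmetric] sum_distrib_right)
    \<comment> \<open>Under \<open>f\<close>, the covering inequality says that the failures of the
      exact tests add up to at least \<open>1 - f (ketbra G G)\<close>.\<close>
    also have "(\<Sum>A\<in>\<A>. f (exact_test E \<theta> A)) \<le> real m - 1 + f (ketbra G G)"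
    proof -
      have "0 \<le> f ((\<Sum>A\<in>\<A>. mat 1 - exact_test E \<theta> A) - (mat 1 - ketbra G G))"
        unfolding G_def using assms(1,3) by (intro f_psd psd_exact_test_cover)
      also have "\<dots> = (\<Sum>A\<in>\<A>. f (mat 1) - f (exact_test E \<theta> A)) - (f (mat 1) - f (ketbra G G))"
        by (simp only: f_linear)
      finally show ?thesis
        by (simp add: f_1 sum_subtractf assms(4))
    qed
    finally have "f (ketbra G G) \<ge> real m * (1 - (1 - \<beta>) / (\<beta> * real N)) - real n * s - real m + 1"
      using tests by linarith
    then show ?thesis
      by (simp add: f_def cinner_eq_trace right_diff_distrib)
  qed
  show ?thesis
    using completeness soundness unfolding Let_def G_def \<Omega>_def s_def by blast
qed

end
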